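(* Let $(\Phi,\Gamma,\mathcal H)$ be a Hermitian scalar quantum field on Minkowski spacetime $\mathbb M^4$ satisfying the Wightman axioms and properties P1 and P2, and let $K$ be the set of double cones of $\mathbb M^4$. Given a nonzero $f\in\mathrm C^1(K,\mathcal D)^{\mathscr P^\uparrow_+}$, define for every 1-simplex $b$ $$[\Phi f](b):=\exp\Big\{i\int_{b_\circledcirc}|f^{ev}_b(x)|\,\mathrm d^4x\cdot\Phi\big(f^{odd}_b\big)\Big\},$$ where $\mathrm d^4x$ is Lebesgue measure and $b_\circledcirc:=|b|\setminus(\partial_1b\cup\partial_0b)$. Then $([\Phi f],\Gamma)$ (with $[\Phi f]$ restricted to $\mathrm T_1(K)$) is a causal and continuously $\mathscr P^\uparrow_+$-covariant connection over $K$. In particular $[\Phi f](b)=1$ for every $b\in\mathrm N_1(K)$.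
   Context: $\mathscr P^\uparrow_+$ is the proper orthochronous Poincaré group. $\Phi$ is an operator-valued distribution on a dense domain $D\subseteq\mathcal H$ ($f\mapsto\Phi(f)$ for Schwartz functions $f$, with $\Phi(f),\Phi(f)^*$ mapping $D$ into $D$), $\Gamma$ is a strongly continuous unitary representation of $\mathscr P^\uparrow_+$ on $\mathcal H$ with $\Gamma_sD\subseteq D$ and $\Gamma_s\Phi(f)\Gamma_s^*=\Phi(f\circ s^{-1})$ on $D$. P1: for every real Schwartz $f$, $\Phi(f)$ is essentially self-adjoint on $D$ (and $\Phi(f)$ denotes its closure). P2: for real Schwartz $f,g$ with spacelike separated supports, $[\exp(i\Phi(f)),\exp(i\Phi(g))]=0$. Double cones: $s(o_R)$, $R>0$, $o_R=\{(t,\mathbf x):|t|+|\mathbf x|<R\}$, $s\in\mathscr P^\uparrow_+$; $K$ ordered by inclusion; $o_1\perp o_2$ iff all points of $o_1$ are spacelike to all points of $o_2$. 1-simplices $b=(|b|;\partial_0b,\partial_1b)$ with $\partial_0b,\partial_1b\subseteq|b|$ in $K$; $\overline b=(|b|;\partial_1b,\partial_0b)$; $s(b)=(s(|b|);s(\partial_0b),s(\partial_1b))$. $\mathrm N_1(K)$: 1-simplices with $\partial_1b\subseteq\partial_0b=|b|$. $\mathrm T_1(K)$: 1-simplices with $\partial_0b\ne|b|\ne\partial_1b$. $\mathrm F(K)$: group generated by $\mathrm T_1(K)$ with $b^{-1}=\overline b$. Path from $a$ to $o$: $b_n\cdots b_1$ with $\partial_1b_1=a$, $\partial_0b_n=o$,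 $\partial_0b_i=\partial_1b_{i+1}$; loop: path $o\to o$; $\mathrm L(K)$: subgroup generated by loops. Support of a word: supports of letters of its reduced form; $w_1\perp w_2$ iff there are $o_1\perp o_2$ in $K$ with the supports of $w_i$ contained in $o_i$. $\mathcal D_a$: real compactly supported smooth functions on $\mathbb R^4$ vanishing outside the closure of $a$; $\mathrm C^1(K,\mathcal D)$: maps $b\mapsto f_b\in\mathcal D_{|b|}$; action $(sf)_b=f_{s(b)}\circ s$; $\mathrm C^1(K,\mathcal D)^{\mathscr P^\uparrow_+}$: fixed points; $f^{ev}_b=\frac12(f_b+f_{\overline b})$, $f^{odd}_b=\frac12(f_b-f_{\overline b})$. A causal and covariant connection over $K$ is a pair $(u,\Gamma)$, $u:\mathrm T_1(K)\to\mathcal U(\mathcal H)$, $\Gamma$ a unitary representation of $\mathscr P^\uparrow_+$ on $\mathcal H$, with (1) $u(\overline b)=u(b)^{-1}$; (2) $\Gamma_su(b)=u(s(b))\Gamma_s$; (3) $u(w_1)u(w_2)=u(w_2)u(w_1)$ for $w_1,w_2\in\mathrm L(K)$ with $w_1\perp w_2$, where $u(b_n\cdots b_1):=u(b_n)\cdots u(b_1)$. It is continuously covariant if $\Gamma$ is strongly continuous. *)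

theory Defs
  imports "HOL-Analysis.Analysis"
begin

text \<open>Spacetime points are vectors in real^4; component 1 is time, 2..4 are space.\<close>

type_synonym pt = "real ^ 4"

definition mink :: "pt \<Rightarrow> pt \<Rightarrow> real" where
  "mink x y = x$1 * y$1 - x$2 * y$2 - x$3 * y$3 - x$4 * y$4"

definition spatial_norm :: "pt \<Rightarrow> real" where
  "spatial_norm x = sqrt ((x$2)^2 + (x$3)^2 + (x$4)^2)"

definition lorentz_po :: "real ^ 4 ^ 4 \<Rightarrow> bool" where
  "lorentz_po L \<longleftrightarrow> (\<forall>x y. mink (L *v x) (L *v y) = mink x y) \<and> det L = 1 \<and> L$1$1 \<ge> 1"

type_synonym poinc_el = "(real ^ 4 ^ 4) \<times> (real ^ 4)"

definition poinc :: "poinc_el set" where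
  "poinc = {(L, a). lorentz_po L}"

definition pact :: "poinc_el \<Rightarrow> pt \<Rightarrow> pt" where
  "pact p x = fst p *v x + snd p"

definition pmult :: "poinc_el \<Rightarrow> poinc_el \<Rightarrow> poinc_el" where
  "pmult p q = (fst p ** fst q, fst p *v snd q + snd p)"

definition pone :: poinc_el where
  "pone = (mat 1, 0)"

definition pinv :: "poinc_el \<Rightarrow> poinc_el" where
  "pinv p = (matrix_inv (fst p), - (matrix_inv (fst p) *v snd p))"

definition spacelike :: "pt \<Rightarrow> bool" where
  "spacelike v \<longleftrightarrow> \<bar>v$1\<bar> < spatial_norm v"

definition perp :: "pt set \<Rightarrow> pt set \<Rightarrow> bool" where
  "perp A B \<longleftrightarrow> (\<forall>x\<in>A. \<forall>y\<in>B. spacelike (x - y))"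

definition dcone0 :: "real \<Rightarrow> pt set" where
  "dcone0 R = {x. \<bar>x$1\<bar> + spatial_norm x < R}"

definition dcones :: "pt set set" where
  "dcones = {pact p ` dcone0 R | p R. p \<in> poinc \<and> R > 0}"

type_synonym spx = "pt set \<times> pt set \<times> pt set"

definition sup1 :: "spx \<Rightarrow> pt set" where "sup1 b = fst b"
definition bd0 :: "spx \<Rightarrow> pt set" where "bd0 b = fst (snd b)"
definition bd1 :: "spx \<Rightarrow> pt set" where "bd1 b = snd (snd b)"

definition simplices1 :: "spx set" where
  "simplices1 = {b. sup1 b \<in> dcones \<and> bd0 b \<in> dcones \<and> bd1 b \<in> dcones
                    \<and> bd0 b \<subseteq> sup1 b \<and> bd1 b \<subseteq> sup1 b}"

definition sbar :: "spx \<Rightarrow> spx" where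
  "sbar b = (sup1 b, bd1 b, bd0 b)"

definition sact :: "poinc_el \<Rightarrow> spx \<Rightarrow> spx" where
  "sact p b = (pact p ` sup1 b, pact p ` bd0 b, pact p ` bd1 b)"

definition N1 :: "spx set" where
  "N1 = {b \<in> simplices1. bd1 b \<subseteq> bd0 b \<and> bd0 b = sup1 b}"

definition T1 :: "spx set" where
  "T1 = {b \<in> simplices1. bd0 b \<noteq> sup1 b \<and> bd1 b \<noteq> sup1 b}"

text \<open>Words in F(K) are lists [b_n, ..., b_1] of elements of T1 standing for b_n \<cdots> b_1.
  Free reduction w.r.t. the relations b (sbar b) = 1.\<close>
fun wreduce :: "spx list \<Rightarrow> spx list" where
  "wreduce [] = []"
| "wreduce (b # w) = (case wreduce w of [] \<Rightarrow> [b]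
                        | c # w' \<Rightarrow> (if c = sbar b then w' else b # c # w'))"

definition winv :: "spx list \<Rightarrow> spx list" where
  "winv w = rev (map sbar w)"

definition is_loop :: "spx list \<Rightarrow> bool" where
  "is_loop w \<longleftrightarrow> w \<noteq> [] \<and> set w \<subseteq> T1
      \<and> (\<forall>j. Suc j < length w \<longrightarrow> bd0 (w ! Suc j) = bd1 (w ! j))
      \<and> bd1 (last w) = bd0 (hd w)"

text \<open>L(K): the subgroup of F(K) generated by loops, elements given by their reduced words.\<close>
definition LK :: "spx list set" where
  "LK = {wreduce (concat ls) | ls. \<forall>l\<in>set ls. is_loop l \<or> is_loop (winv l)}"

definition wperp :: "spx list \<Rightarrow> spx list \<Rightarrow> bool" where
  "wperp w1 w2 \<longleftrightarrow> (\<exists>o1\<in>dcones. \<exists>o2\<in>dcones. perp o1 o2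
       \<and> (\<forall>b\<in>set w1. sup1 b \<subseteq> o1) \<and> (\<forall>b\<in>set w2. sup1 b \<subseteq> o2))"

definition uword :: "(spx \<Rightarrow> 'h \<Rightarrow> 'h) \<Rightarrow> spx list \<Rightarrow> 'h \<Rightarrow> 'h" where
  "uword u w = foldr (\<circ>) (map u w) id"

text \<open>A complex Hilbert space is modelled as a real Hilbert space (type class
  real_inner + complete_space) together with a complex scalar multiplication sc
  extending the real one, for which multiplication by i is orthogonal.
  The complex inner product (antilinear in the first slot) is cinner.\<close>

definition complex_structure :: "(complex \<Rightarrow> 'h::{real_inner,complete_space} \<Rightarrow> 'h) \<Rightarrow> bool" where
  "complex_structure sc \<longleftrightarrow>
     (\<forall>r x. sc (complex_of_real r) x = r *\<^sub>R x)
   \<and> (\<forall>a b x. sc (a * b) x = sc a (sc b x))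
   \<and> (\<forall>a b x. sc (a + b) x = sc a x + sc b x)
   \<and> (\<forall>a x y. sc a (x + y) = sc a x + sc a y)
   \<and> (\<forall>x y. inner (sc \<i> x) (sc \<i> y) = inner x y)"

definition cinner :: "(complex \<Rightarrow> 'h::real_inner \<Rightarrow> 'h) \<Rightarrow> 'h \<Rightarrow> 'h \<Rightarrow> complex" where
  "cinner sc x y = Complex (inner x y) (inner (sc \<i> x) y)"

definition unitary :: "(complex \<Rightarrow> 'h::real_normed_vector \<Rightarrow> 'h) \<Rightarrow> ('h \<Rightarrow> 'h) \<Rightarrow> bool" where
  "unitary sc U \<longleftrightarrow> (\<forall>x y. U (x + y) = U x + U y) \<and> (\<forall>c x. U (sc c x) = sc c (U x))
                    \<and> bij U \<and> (\<forall>x. norm (U x) = norm x)"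

text \<open>(Possibly unbounded) operators are represented by their graphs.\<close>
definition graph_on :: "'h set \<Rightarrow> ('h \<Rightarrow> 'h) \<Rightarrow> ('h \<times> 'h) set" where
  "graph_on D A = {(x, A x) | x. x \<in> D}"

definition op_closure :: "'h::real_normed_vector set \<Rightarrow> ('h \<Rightarrow> 'h) \<Rightarrow> ('h \<times> 'h) set" where
  "op_closure D A = closure (graph_on D A)"

definition adjoint_graph :: "(complex \<Rightarrow> 'h::real_inner \<Rightarrow> 'h) \<Rightarrow> ('h \<times> 'h) set \<Rightarrow> ('h \<times> 'h) set" where
  "adjoint_graph sc G = {(y, z). \<forall>(x, w)\<in>G. cinner sc w y = cinner sc x z}"

definition self_adjoint :: "(complex \<Rightarrow> 'h::real_inner \<Rightarrow> 'h) \<Rightarrow> ('h \<times> 'h) set \<Rightarrow> bool" where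
  "self_adjoint sc G \<longleftrightarrow> adjoint_graph sc G = G"

definition ess_self_adjoint :: "(complex \<Rightarrow> 'h::real_inner \<Rightarrow> 'h) \<Rightarrow> 'h set \<Rightarrow> ('h \<Rightarrow> 'h) \<Rightarrow> bool" where
  "ess_self_adjoint sc D A \<longleftrightarrow> self_adjoint sc (op_closure D A)"

text \<open>U is the strongly continuous one-parameter unitary group t \<mapsto> exp(i t A)
  generated by the (graph of the) operator A (Stone's theorem: for self-adjoint A it exists
  and is unique).\<close>
definition unitary_group_of :: "(complex \<Rightarrow> 'h::{real_inner,complete_space} \<Rightarrow> 'h) \<Rightarrow> (real \<Rightarrow> 'h \<Rightarrow> 'h) \<Rightarrow> ('h \<times> 'h) set \<Rightarrow> bool" where
  "unitary_group_of sc U G \<longleftrightarrow>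
     (\<forall>t. unitary sc (U t)) \<and> U 0 = id \<and> (\<forall>s t. U (s + t) = U s \<circ> U t)
   \<and> (\<forall>x. continuous_on UNIV (\<lambda>t. U t x))
   \<and> (\<forall>x y. (x, y) \<in> G \<longleftrightarrow> ((\<lambda>t. U t x) has_vector_derivative sc \<i> y) (at 0))"

definition uexp :: "(complex \<Rightarrow> 'h::{real_inner,complete_space} \<Rightarrow> 'h) \<Rightarrow> ('h \<times> 'h) set \<Rightarrow> real \<Rightarrow> 'h \<Rightarrow> 'h" where
  "uexp sc G t = (THE U. unitary_group_of sc U G) t"

definition unitary_rep :: "(complex \<Rightarrow> 'h::{real_inner,complete_space} \<Rightarrow> 'h) \<Rightarrow> (poinc_el \<Rightarrow> 'h \<Rightarrow> 'h) \<Rightarrow> bool" where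
  "unitary_rep sc \<Gamma> \<longleftrightarrow> (\<forall>p\<in>poinc. unitary sc (\<Gamma> p)) \<and> \<Gamma> pone = id
     \<and> (\<forall>p\<in>poinc. \<forall>q\<in>poinc. \<Gamma> (pmult p q) = \<Gamma> p \<circ> \<Gamma> q)"

definition strongly_continuous :: "(poinc_el \<Rightarrow> 'h::real_normed_vector \<Rightarrow> 'h) \<Rightarrow> bool" where
  "strongly_continuous \<Gamma> \<longleftrightarrow> (\<forall>x. continuous_on poinc (\<lambda>p. \<Gamma> p x))"

definition tsupp :: "(pt \<Rightarrow> 'a::zero) \<Rightarrow> pt set" where
  "tsupp g = closure {x. g x \<noteq> 0}"

definition dpart :: "4 \<Rightarrow> (pt \<Rightarrow> complex) \<Rightarrow> pt \<Rightarrow> complex" where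
  "dpart i f x = vector_derivative (\<lambda>h. f (x + h *\<^sub>R axis i 1)) (at 0)"

fun iter_part :: "4 list \<Rightarrow> (pt \<Rightarrow> complex) \<Rightarrow> pt \<Rightarrow> complex" where
  "iter_part [] f = f"
| "iter_part (i # is) f = dpart i (iter_part is f)"

definition smooth :: "(pt \<Rightarrow> complex) \<Rightarrow> bool" where
  "smooth f \<longleftrightarrow> (\<forall>is. continuous_on UNIV (iter_part is f)
      \<and> (\<forall>i x. (\<lambda>h. iter_part is f (x + h *\<^sub>R axis i 1)) differentiable (at 0)))"

definition schwartz :: "(pt \<Rightarrow> complex) \<Rightarrow> bool" where
  "schwartz f \<longleftrightarrow> smooth f \<and>
     (\<forall>is k. bounded (range (\<lambda>x. (1 + norm x) ^ k * norm (iter_part is f x))))"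

definition snorm :: "nat \<Rightarrow> 4 list \<Rightarrow> (pt \<Rightarrow> complex) \<Rightarrow> real" where
  "snorm k is f = (SUP x. (1 + norm x) ^ k * norm (iter_part is f x))"

definition test_fun :: "pt set \<Rightarrow> (pt \<Rightarrow> real) \<Rightarrow> bool" where
  "test_fun a g \<longleftrightarrow> smooth (\<lambda>x. complex_of_real (g x)) \<and> compact (tsupp g)
                      \<and> (\<forall>x. x \<notin> closure a \<longrightarrow> g x = 0)"

definition spacelike_sets :: "pt set \<Rightarrow> pt set \<Rightarrow> bool" where
  "spacelike_sets A B \<longleftrightarrow> perp A B"

definition cspan :: "(complex \<Rightarrow> 'h::real_vector \<Rightarrow> 'h) \<Rightarrow> 'h set \<Rightarrow> 'h set" where
  "cspan sc S = span {sc c x | c x. x \<in> S}"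

inductive_set field_polys :: "((pt \<Rightarrow> complex) \<Rightarrow> 'h \<Rightarrow> 'h) \<Rightarrow> 'h \<Rightarrow> 'h set"
  for \<Phi> \<Omega> where
  "\<Omega> \<in> field_polys \<Phi> \<Omega>"
| "x \<in> field_polys \<Phi> \<Omega> \<Longrightarrow> schwartz f \<Longrightarrow> \<Phi> f x \<in> field_polys \<Phi> \<Omega>"

definition forward_cone :: "pt set" where
  "forward_cone = {p. p$1 \<ge> spatial_norm p}"

text \<open>Spectrum condition: the Fourier transform of a \<mapsto> <psi, U(a) chi>
  (U(a) = Gamma(1,a) = exp(i P.a)) is supported in the closed forward cone.\<close>
definition spectrum_condition :: "(complex \<Rightarrow> 'h::{real_inner,complete_space} \<Rightarrow> 'h) \<Rightarrow> (poinc_el \<Rightarrow> 'h \<Rightarrow> 'h) \<Rightarrow> bool" where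
  "spectrum_condition sc \<Gamma> \<longleftrightarrow>
    (\<forall>\<psi> \<phi> h. smooth h \<and> compact (tsupp h) \<and> tsupp h \<inter> forward_cone = {} \<longrightarrow>
       integral\<^sup>L lborel (\<lambda>a. (integral\<^sup>L lborel (\<lambda>q. h q * cis (- mink q a)))
                          * cinner sc \<psi> (\<Gamma> (mat 1, a) \<phi>)) = 0)"

definition wightman_field ::
  "(complex \<Rightarrow> 'h::{real_inner,complete_space} \<Rightarrow> 'h) \<Rightarrow> (poinc_el \<Rightarrow> 'h \<Rightarrow> 'h) \<Rightarrow> 'h set
    \<Rightarrow> ((pt \<Rightarrow> complex) \<Rightarrow> 'h \<Rightarrow> 'h) \<Rightarrow> 'h \<Rightarrow> bool" where
  "wightman_field sc \<Gamma> D \<Phi> \<Omega> \<longleftrightarrow>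
     complex_structure sc
   \<comment> \<open>unitary representation, invariant dense domain\<close>
   \<and> unitary_rep sc \<Gamma> \<and> strongly_continuous \<Gamma>
   \<and> closure D = UNIV \<and> (\<forall>x\<in>D. \<forall>y\<in>D. x + y \<in> D) \<and> (\<forall>c. \<forall>x\<in>D. sc c x \<in> D)
   \<and> (\<forall>p\<in>poinc. \<Gamma> p ` D \<subseteq> D)
   \<comment> \<open>spectrum condition\<close>
   \<and> spectrum_condition sc \<Gamma>
   \<comment> \<open>vacuum: invariant, unique up to scalars among translation invariant vectors\<close>
   \<and> \<Omega> \<in> D \<and> norm \<Omega> = 1 \<and> (\<forall>p\<in>poinc. \<Gamma> p \<Omega> = \<Omega>)
   \<and> (\<forall>\<psi>. (\<forall>a. \<Gamma> (mat 1, a) \<psi> = \<psi>) \<longrightarrow> (\<exists>c. \<psi> = sc c \<Omega>))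
   \<comment> \<open>operator-valued tempered distribution on D\<close>
   \<and> (\<forall>f. schwartz f \<longrightarrow> \<Phi> f ` D \<subseteq> D)
   \<and> (\<forall>f. schwartz f \<longrightarrow> (\<forall>x\<in>D. \<forall>y\<in>D. \<Phi> f (x + y) = \<Phi> f x + \<Phi> f y)
                       \<and> (\<forall>c. \<forall>x\<in>D. \<Phi> f (sc c x) = sc c (\<Phi> f x)))
   \<and> (\<forall>f g. schwartz f \<longrightarrow> schwartz g \<longrightarrow> (\<forall>x\<in>D. \<Phi> (\<lambda>y. f y + g y) x = \<Phi> f x + \<Phi> g x))
   \<and> (\<forall>f c. schwartz f \<longrightarrow> (\<forall>x\<in>D. \<Phi> (\<lambda>y. c * f y) x = sc c (\<Phi> f x)))
   \<and> (\<forall>\<psi>\<in>D. \<forall>\<phi>\<in>D. \<exists>C N. \<forall>f. schwartz f \<longrightarrow>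
        cmod (cinner sc \<psi> (\<Phi> f \<phi>)) \<le> C * Max {snorm k is f | k is. k \<le> N \<and> length is \<le> N})
   \<comment> \<open>Hermitian: Phi(f)* extends Phi(conj f) on D (in particular Phi(f)* maps D into D)\<close>
   \<and> (\<forall>f. schwartz f \<longrightarrow> (\<forall>\<psi>\<in>D. \<forall>\<phi>\<in>D. cinner sc \<psi> (\<Phi> f \<phi>) = cinner sc (\<Phi> (\<lambda>y. cnj (f y)) \<psi>) \<phi>))
   \<comment> \<open>covariance\<close>
   \<and> (\<forall>p\<in>poinc. \<forall>f. schwartz f \<longrightarrow> (\<forall>\<psi>\<in>D. \<Gamma> p (\<Phi> f (\<Gamma> (pinv p) \<psi>)) = \<Phi> (f \<circ> pact (pinv p)) \<psi>))
   \<comment> \<open>locality\<close>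
   \<and> (\<forall>f g. schwartz f \<longrightarrow> schwartz g \<longrightarrow> spacelike_sets (tsupp f) (tsupp g) \<longrightarrow>
        (\<forall>\<psi>\<in>D. \<Phi> f (\<Phi> g \<psi>) = \<Phi> g (\<Phi> f \<psi>)))
   \<comment> \<open>cyclicity of the vacuum\<close>
   \<and> closure (cspan sc (field_polys \<Phi> \<Omega>)) = UNIV"

definition propP1 :: "(complex \<Rightarrow> 'h::{real_inner,complete_space} \<Rightarrow> 'h) \<Rightarrow> 'h set \<Rightarrow> ((pt \<Rightarrow> complex) \<Rightarrow> 'h \<Rightarrow> 'h) \<Rightarrow> bool" where
  "propP1 sc D \<Phi> \<longleftrightarrow> (\<forall>g::pt \<Rightarrow> real. schwartz (\<lambda>x. complex_of_real (g x)) \<longrightarrow>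
       ess_self_adjoint sc D (\<Phi> (\<lambda>x. complex_of_real (g x))))"

definition propP2 :: "(complex \<Rightarrow> 'h::{real_inner,complete_space} \<Rightarrow> 'h) \<Rightarrow> 'h set \<Rightarrow> ((pt \<Rightarrow> complex) \<Rightarrow> 'h \<Rightarrow> 'h) \<Rightarrow> bool" where
  "propP2 sc D \<Phi> \<longleftrightarrow> (\<forall>f g::pt \<Rightarrow> real.
       schwartz (\<lambda>x. complex_of_real (f x)) \<longrightarrow> schwartz (\<lambda>x. complex_of_real (g x)) \<longrightarrow>
       spacelike_sets (tsupp f) (tsupp g) \<longrightarrow>
       uexp sc (op_closure D (\<Phi> (\<lambda>x. complex_of_real (f x)))) 1
         \<circ> uexp sc (op_closure D (\<Phi> (\<lambda>x. complex_of_real (g x)))) 1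
     = uexp sc (op_closure D (\<Phi> (\<lambda>x. complex_of_real (g x)))) 1
         \<circ> uexp sc (op_closure D (\<Phi> (\<lambda>x. complex_of_real (f x)))) 1)"

definition cochain1 :: "(spx \<Rightarrow> pt \<Rightarrow> real) \<Rightarrow> bool" where
  "cochain1 f \<longleftrightarrow> (\<forall>b\<in>simplices1. test_fun (sup1 b) (f b))"

definition inv_cochain1 :: "(spx \<Rightarrow> pt \<Rightarrow> real) \<Rightarrow> bool" where
  "inv_cochain1 f \<longleftrightarrow> cochain1 f \<and> (\<forall>p\<in>poinc. \<forall>b\<in>simplices1. f (sact p b) \<circ> pact p = f b)"

definition fev :: "(spx \<Rightarrow> pt \<Rightarrow> real) \<Rightarrow> spx \<Rightarrow> pt \<Rightarrow> real" where
  "fev f b x = (f b x + f (sbar b) x) / 2"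

definition fodd :: "(spx \<Rightarrow> pt \<Rightarrow> real) \<Rightarrow> spx \<Rightarrow> pt \<Rightarrow> real" where
  "fodd f b x = (f b x - f (sbar b) x) / 2"

definition interior_s :: "spx \<Rightarrow> pt set" where
  "interior_s b = sup1 b - (bd1 b \<union> bd0 b)"

definition Phi_conn :: "(complex \<Rightarrow> 'h::{real_inner,complete_space} \<Rightarrow> 'h) \<Rightarrow> 'h set \<Rightarrow> ((pt \<Rightarrow> complex) \<Rightarrow> 'h \<Rightarrow> 'h)
     \<Rightarrow> (spx \<Rightarrow> pt \<Rightarrow> real) \<Rightarrow> spx \<Rightarrow> 'h \<Rightarrow> 'h" where
  "Phi_conn sc D \<Phi> f b =
     uexp sc (op_closure D (\<Phi> (\<lambda>x. complex_of_real (fodd f b x))))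
          (LINT x : interior_s b | lborel. \<bar>fev f b x\<bar>)"

definition causal_cov_connection :: "(complex \<Rightarrow> 'h::{real_inner,complete_space} \<Rightarrow> 'h) \<Rightarrow> (spx \<Rightarrow> 'h \<Rightarrow> 'h) \<Rightarrow> (poinc_el \<Rightarrow> 'h \<Rightarrow> 'h) \<Rightarrow> bool" where
  "causal_cov_connection sc u \<Gamma> \<longleftrightarrow>
     unitary_rep sc \<Gamma>
   \<and> (\<forall>b\<in>T1. unitary sc (u b))
   \<and> (\<forall>b\<in>T1. u (sbar b) = inv (u b))
   \<and> (\<forall>p\<in>poinc. \<forall>b\<in>T1. \<Gamma> p \<circ> u b = u (sact p b) \<circ> \<Gamma> p)
   \<and> (\<forall>w1\<in>LK. \<forall>w2\<in>LK. wperp w1 w2 \<longrightarrow> uword u w1 \<circ> uword u w2 = uword u w2 \<circ> uword u w1)"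

definition cont_covariant :: "(poinc_el \<Rightarrow> 'h::real_normed_vector \<Rightarrow> 'h) \<Rightarrow> bool" where
  "cont_covariant \<Gamma> \<longleftrightarrow> strongly_continuous \<Gamma>"

end

(*  A real Hilbert space carrying i as an orthogonal map turns a self-adjoint operator A into a
    skew-adjoint one, i A, whose resolvents J h = (1 - h i A)^(-1) are contractions. The backward Euler
    products J (t / 2^n) ^^ 2^n converge to the unitary group exp (i t A): this is Stone's theorem.
    Uniqueness of the group turns covariance and linearity of the field into covariance and
    antisymmetry of the exponentials, once the weights are seen to be invariant because Poincare
    transformations preserve Lebesgue measure. Causality holds already for single letters of the
    words: test functions of causally disjoint double cones o1, o2 may have supports touching along
    a light ray, but there is a translation direction a such that o1 + e a and o2 have spacelike
    separated closures for all e > 0, and strong continuity of the representation permits e -> 0.  *)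

theory Submission
  imports Defs
begin

section \<open>Contraction resolvents of a skew-adjoint operator\<close>

text \<open>Up to the one-parameter group only the real inner product is used: the orthogonal
  splitting along a skew-adjoint graph yields the resolvents, and complex linearity is recovered
  afterwards because the graph is invariant under i. The limit is taken along powers of two since
  one refinement then replaces each step by two half steps. The local error is quadratic in the step
  length, so 2^n steps lose only O(1 / 2^n) in total and successive differences are summable. The
  error constant requires vectors to which the operator can be applied twice; these are dense, and
  since all maps involved are nonexpansive, the limits extend to the whole space. In the field part,
  \<open>Phi_conn\<close> is read as a one-parameter group evaluated at the time
  \<open>weight b\<close>, whereas P2 speaks of time 1 only; other times are absorbed into the test
  functions.\<close>

lemma closed_subspace_projection:
  fixes S :: "'a::{real_inner,complete_space} set"
  assumes "closed S" "subspace S"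
  shows "\<exists>p\<in>S. \<forall>s\<in>S. inner (z - p) s = 0"
proof -
  define F where "F = (\<lambda>s. (norm (z - s))\<^sup>2)"
  define d where "d = (INF s\<in>S. F s)"
  have S0: "0 \<in> S" using assms(2) by (rule subspace_0)
  have bdd: "bdd_below (F ` S)" by (rule bdd_belowI[of _ 0]) (auto simp: F_def)
  have low: "d \<le> F s" if "s \<in> S" for s
    unfolding d_def by (rule cINF_lower[OF bdd that])
  have "\<exists>s\<in>S. F s < d + inverse (real (Suc n))" for n
  proof -
    have "Inf (F ` S) < d + inverse (real (Suc n))" by (simp add: d_def)
    then show ?thesis using S0 cInf_lessD[of "F ` S" "d + inverse (real (Suc n))"] by blast
  qed
  then obtain p where pS: "\<And>n. p n \<in> S" and pF: "\<And>n. F (p n) < d + inverse (real (Suc n))"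
    by metis
  \<comment> \<open>Parallelogram law: the midpoint stays in \<open>S\<close>, so its term is at
    least \<open>4 * d\<close> and the minimising sequence is Cauchy.\<close>
  have par: "(norm (p n - p m))\<^sup>2 = 2 * F (p n) + 2 * F (p m) - 4 * F ((1/2) *\<^sub>R (p n + p m))" for n m
    unfolding F_def power2_norm_eq_inner
    by (simp add: inner_simps inner_commute algebra_simps)
  have dist: "(norm (p n - p m))\<^sup>2 < 4 * inverse (real (Suc N))" if "N \<le> n" "N \<le> m" for N n m
  proof -
    have "(1/2) *\<^sub>R (p n + p m) \<in> S" by (simp add: assms(2) pS subspace_add subspace_scale)
    then have "d \<le> F ((1/2) *\<^sub>R (p n + p m))" by (rule low)
    moreover have "inverse (real (Suc n)) \<le> inverse (real (Suc N))"
      "inverse (real (Suc m)) \<le> inverse (real (Suc N))"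
      using that by (simp_all add: divide_simps)
    ultimately show ?thesis using par[of n m] pF[of n] pF[of m] by linarith
  qed
  have "Cauchy p"
  proof (rule CauchyI)
    fix e :: real assume "e > 0"
    then obtain N where N: "inverse (real (Suc N)) < e\<^sup>2 / 4"
      using reals_Archimedean[of "e\<^sup>2/4"] by auto
    have "norm (p m - p n) < e" if "m \<ge> N" "n \<ge> N" for m n
    proof (rule power_less_imp_less_base[where n=2])
      show "(norm (p m - p n))\<^sup>2 < e\<^sup>2" using dist[of N m n] that N by linarith
    qed (use \<open>e > 0\<close> in simp)
    then show "\<exists>M. \<forall>m\<ge>M. \<forall>n\<ge>M. norm (p m - p n) < e" by blast
  qed
  then obtain q where q: "p \<longlonglongrightarrow> q" using Cauchy_convergent convergent_def by blast
  have qS: "q \<in> S" using closed_sequentially[OF assms(1) _ q] pS by blast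
  have "(\<lambda>n. F (p n)) \<longlonglongrightarrow> F q" unfolding F_def by (intro tendsto_intros q)
  moreover have "(\<lambda>n. d + inverse (real (Suc n))) \<longlonglongrightarrow> d + 0"
    by (intro tendsto_intros LIMSEQ_inverse_real_of_nat)
  ultimately have "F q \<le> d + 0" by (rule LIMSEQ_le) (use pF less_imp_le in blast)
  then have min: "F q \<le> F s" if "s \<in> S" for s using low[OF that] by simp
  have "inner (z - q) s = 0" if "s \<in> S" for s
  proof (cases "s = 0")
    case False
    \<comment> \<open>The minimum point of the quadratic polynomial
      \<open>F (q + t *\<^sub>R s)\<close> in \<open>t\<close>; it would beat \<open>q\<close>
      unless the inner product vanishes.\<close>
    define t where "t = inner (z - q) s / inner s s"
    have "q + t *\<^sub>R s \<in> S" by (simp add: assms(2) qS subspace_add subspace_scale that)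
    then have "F q \<le> F (q + t *\<^sub>R s)" by (rule min)
    also have "F (q + t *\<^sub>R s) = F q - 2 * t * inner (z - q) s + t\<^sup>2 * inner s s"
      unfolding F_def power2_norm_eq_inner
      by (simp add: inner_simps inner_commute algebra_simps power2_eq_square)
    also have "\<dots> = F q - (inner (z - q) s)\<^sup>2 / inner s s"
      using False by (simp add: t_def power2_eq_square)
    finally have "(inner (z - q) s)\<^sup>2 / inner s s \<le> 0" by simp
    then show ?thesis using False
      by (simp add: divide_le_0_iff) (metis inner_gt_zero_iff not_le)
  qed simp
  then show ?thesis using qS by blast
qed

text \<open>The operator enters as its graph. The forward direction of \<open>adj\<close> is
  skew-symmetry, the backward direction is maximality; linearity and closedness of the graph follow
  from the equivalence.\<close>

locale skew_adjoint =
  fixes B :: "('a::{real_inner,complete_space} \<times> 'a) set"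
  assumes dense: "closure (fst ` B) = UNIV"
    and adj: "(y, z) \<in> B \<longleftrightarrow> (\<forall>x w. (x, w) \<in> B \<longrightarrow> inner w y = - inner x z)"

text \<open>With the factor \<open>- h\<close> this reduces solving
  \<open>y = x - h *\<^sub>R w\<close> on the graph to the case \<open>y = x + w\<close> of
  \<open>range_one_plus\<close>.\<close>

lemma (in skew_adjoint) scale:
  assumes "h \<noteq> 0"
  shows "skew_adjoint {(x, h *\<^sub>R w) | x w. (x, w) \<in> B}" (is "skew_adjoint ?C")
proof
  have "fst ` ?C = fst ` B" by force
  then show "closure (fst ` ?C) = UNIV" using dense by simp
  fix y z
  have "(y, z) \<in> ?C \<longleftrightarrow> (y, inverse h *\<^sub>R z) \<in> B"
    using assms by force
  also have "\<dots> \<longleftrightarrow> (\<forall>x w. (x, w) \<in> B \<longrightarrow> h * inner w y = - inner x z)"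
    using assms by (subst adj) (auto simp: field_simps)
  also have "\<dots> \<longleftrightarrow> (\<forall>x w. (x, w) \<in> ?C \<longrightarrow> inner w y = - inner x z)"
    by (intro iffI allI impI) (force, fastforce)
  finally show "(y, z) \<in> ?C \<longleftrightarrow> (\<forall>x w. (x, w) \<in> ?C \<longrightarrow> inner w y = - inner x z)" .
qed

context skew_adjoint
begin

lemma graph_inner: "(x, w) \<in> B \<Longrightarrow> (y, z) \<in> B \<Longrightarrow> inner w y = - inner x z"
  using adj by blast

lemma graph_orth: "(x, w) \<in> B \<Longrightarrow> inner w x = 0"
  using graph_inner[of x w x w] by (simp add: inner_commute)

lemma graph_add: "(x, w) \<in> B \<Longrightarrow> (y, z) \<in> B \<Longrightarrow> (x + y, w + z) \<in> B"
  unfolding adj[of "x + y"] by (auto simp: inner_simps graph_inner)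

lemma graph_scale: "(x, w) \<in> B \<Longrightarrow> (c *\<^sub>R x, c *\<^sub>R w) \<in> B"
  unfolding adj[of "c *\<^sub>R x"] by (auto simp: inner_simps graph_inner)

lemma graph_diff: "(x, w) \<in> B \<Longrightarrow> (y, z) \<in> B \<Longrightarrow> (x - y, w - z) \<in> B"
  using graph_add[of x w "(-1) *\<^sub>R y" "(-1) *\<^sub>R z"] graph_scale[of y z "-1"] by simp

lemma graph_subspace: "subspace B"
proof -
  have "(0, 0) \<in> B" unfolding adj[of 0] by simp
  then show ?thesis
    by (auto simp: subspace_def graph_add graph_scale zero_prod_def)
qed

text \<open>As an adjoint, the graph is cut out by continuous linear equations, one for each of its
  points.\<close>

lemma graph_closed: "closed B"
proof -
  have "B = (\<Inter>(x, w)\<in>B. {p. inner w (fst p) = - inner x (snd p)})"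
  proof (rule set_eqI)
    fix p :: "'a \<times> 'a"
    obtain y z where p: "p = (y, z)" by (cases p)
    show "p \<in> B \<longleftrightarrow> p \<in> (\<Inter>(x, w)\<in>B. {p. inner w (fst p) = - inner x (snd p)})"
      unfolding p adj[of y z] by auto
  qed
  moreover have "closed \<dots>"
    by (intro closed_INT ballI) (auto intro!: closed_Collect_eq continuous_intros)
  ultimately show ?thesis by simp
qed

text \<open>Skew-symmetry makes \<open>w\<close> orthogonal to \<open>x\<close>. This identity gives
  both the uniqueness of solutions of the resolvent equation and the contraction bound.\<close>

lemma pythagoras: "(x, w) \<in> B \<Longrightarrow> (norm (x - h *\<^sub>R w))\<^sup>2 = (norm x)\<^sup>2 + h\<^sup>2 * (norm w)\<^sup>2"
  using graph_orth[of x w] unfolding power2_norm_eq_inner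
  by (simp add: inner_simps inner_commute power2_eq_square)

text \<open>The orthogonal complement of the graph is its reflection, by skew-adjointness.\<close>

lemma range_one_plus: "\<exists>x w. (x, w) \<in> B \<and> y = x + w"
proof -
  obtain p where p: "p \<in> B" "\<forall>s\<in>B. inner ((y, 0) - p) s = 0"
    using closed_subspace_projection[OF graph_closed graph_subspace] by blast
  obtain x w where xw: "p = (x, w)" by (cases p)
  have "(- w, y - x) \<in> B"
    unfolding adj[of "- w"] using p(2) xw by (fastforce simp: inner_commute)
  \<comment> \<open>Adding the graph point \<open>p\<close> makes the two coordinates sum to
    \<open>y\<close>.\<close>
  then have "(x + - w, w + (y - x)) \<in> B" using p(1) xw graph_add by blast
  then show ?thesis by (rule_tac x="x + - w" in exI, rule_tac x="w + (y - x)" in exI) simp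
qed

lemma range_resolvent:
  assumes "h \<noteq> 0"
  shows "\<exists>x w. (x, w) \<in> B \<and> y = x - h *\<^sub>R w"
proof -
  interpret C: skew_adjoint "{(x, (- h) *\<^sub>R w) | x w. (x, w) \<in> B}"
    by (rule scale) (use assms in simp)
  show ?thesis using C.range_one_plus[of y] by force
qed

lemma resolvent_unique:
  assumes "(x, w) \<in> B" "(x', w') \<in> B" "x - h *\<^sub>R w = x' - h *\<^sub>R w'"
  shows "x = x'"
proof -
  have "(norm ((x - x') - h *\<^sub>R (w - w')))\<^sup>2 = (norm (x - x'))\<^sup>2 + h\<^sup>2 * (norm (w - w'))\<^sup>2"
    by (rule pythagoras) (use assms graph_diff in blast)
  moreover have "(x - x') - h *\<^sub>R (w - w') = 0" using assms(3) by (simp add: algebra_simps)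
  ultimately have "(norm (x - x'))\<^sup>2 + h\<^sup>2 * (norm (w - w'))\<^sup>2 = 0" by simp
  then show ?thesis by (simp add: add_nonneg_eq_0_iff)
qed

text \<open>For \<open>h = 0\<close> the equation would only be solvable on the domain of \<open>B\<close>, hence the case distinction.\<close>

definition J :: "real \<Rightarrow> 'a \<Rightarrow> 'a" where
  "J h y = (if h = 0 then y else THE x. \<exists>w. (x, w) \<in> B \<and> y = x - h *\<^sub>R w)"

lemma J_zero [simp]: "J 0 = id"
  by (auto simp: J_def)

lemma J_eq: "(x, w) \<in> B \<Longrightarrow> J h (x - h *\<^sub>R w) = x"
  unfolding J_def by (auto intro!: the_equality dest: resolvent_unique)

lemma J_obtain:
  assumes "h \<noteq> 0"
  obtains w where "(J h y, w) \<in> B" "y = J h y - h *\<^sub>R w"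
  using range_resolvent[OF assms, of y] J_eq by metis

lemma J_add: "J h (x + y) = J h x + J h y"
proof (cases "h = 0")
  case False
  obtain a where a: "(J h x, a) \<in> B" "x = J h x - h *\<^sub>R a" by (rule J_obtain[OF False])
  obtain b where b: "(J h y, b) \<in> B" "y = J h y - h *\<^sub>R b" by (rule J_obtain[OF False])
  have "J h ((J h x + J h y) - h *\<^sub>R (a + b)) = J h x + J h y"
    by (rule J_eq) (use a b graph_add in blast)
  moreover have "(J h x + J h y) - h *\<^sub>R (a + b) = (J h x - h *\<^sub>R a) + (J h y - h *\<^sub>R b)"
    by (simp add: algebra_simps)
  then have "(J h x + J h y) - h *\<^sub>R (a + b) = x + y"
    by (simp only: a(2)[symmetric] b(2)[symmetric])
  ultimately show ?thesis by simp
qed simp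

lemma J_scale: "J h (c *\<^sub>R x) = c *\<^sub>R J h x"
proof (cases "h = 0")
  case False
  obtain a where a: "(J h x, a) \<in> B" "x = J h x - h *\<^sub>R a" by (rule J_obtain[OF False])
  have "J h (c *\<^sub>R J h x - h *\<^sub>R (c *\<^sub>R a)) = c *\<^sub>R J h x"
    by (rule J_eq) (use a graph_scale in blast)
  moreover have "c *\<^sub>R J h x - h *\<^sub>R (c *\<^sub>R a) = c *\<^sub>R x"
    by (subst (2) a(2)) (simp add: algebra_simps)
  ultimately show ?thesis by simp
qed simp

lemma J_diff: "J h (x - y) = J h x - J h y"
  using J_add[of h "x - y" y] by simp

lemma J_norm: "norm (J h x) \<le> norm x"
proof (cases "h = 0")
  case False
  obtain a where a: "(J h x, a) \<in> B" "x = J h x - h *\<^sub>R a" by (rule J_obtain[OF False])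
  have "(norm x)\<^sup>2 = (norm (J h x))\<^sup>2 + h\<^sup>2 * (norm a)\<^sup>2"
    using pythagoras[OF a(1), of h] a(2) by simp
  then have "(norm (J h x))\<^sup>2 \<le> (norm x)\<^sup>2" by simp
  then show ?thesis by (rule power2_le_imp_le) simp
qed simp

lemma J_nonexp: "norm (J h x - J h y) \<le> norm (x - y)"
  by (metis J_diff J_norm)

text \<open>The operator value \<open>q\<close> at \<open>J h x\<close> is the difference quotient
  \<open>(J h x - x) / h\<close>, a combination of domain vectors and hence in the domain itself;
  the resolvent equation for it then reads \<open>q = J h w\<close>.\<close>

lemma J_graph_step:
  assumes "(x, w) \<in> B"
  shows "(J h x, J h w) \<in> B \<and> J h x - x = h *\<^sub>R J h w"
proof (cases "h = 0")
  case False
  obtain q where q: "(J h x, q) \<in> B" "x = J h x - h *\<^sub>R q" by (rule J_obtain[OF False])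
  have "(J h x - x, q - w) \<in> B" using q(1) assms by (rule graph_diff)
  moreover have hq: "J h x - x = h *\<^sub>R q" by (subst (2) q(2)) simp
  ultimately have "((1/h) *\<^sub>R (h *\<^sub>R q), (1/h) *\<^sub>R (q - w)) \<in> B" using graph_scale by metis
  then have "(q, (1/h) *\<^sub>R (q - w)) \<in> B" using False by simp
  then have "J h (q - h *\<^sub>R (1/h) *\<^sub>R (q - w)) = q" by (rule J_eq)
  then have "J h w = q" using False by simp
  then show ?thesis using q hq by simp
qed (use assms in simp)

lemma J_graph: "(x, w) \<in> B \<Longrightarrow> (J h x, J h w) \<in> B"
  and J_step: "(x, w) \<in> B \<Longrightarrow> J h x - x = h *\<^sub>R J h w"
  by (rule J_graph_step[THEN conjunct1], assumption) (rule J_graph_step[THEN conjunct2], assumption)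

lemma J_commute: "J h (J k y) = J k (J h y)"
proof (cases "k = 0")
  case False
  obtain w where w: "(J k y, w) \<in> B" "y = J k y - k *\<^sub>R w" by (rule J_obtain[OF False])
  have "J k (J h (J k y) - k *\<^sub>R J h w) = J h (J k y)" by (intro J_eq J_graph w)
  moreover have "J h (J k y) - k *\<^sub>R J h w = J h y"
    by (subst (2) w(2)) (simp add: J_diff J_scale)
  ultimately show ?thesis by simp
qed simp

lemma J_near: 
  assumes "(x, w) \<in> B" shows "norm (J h x - x) \<le> \<bar>h\<bar> * norm w"
  using J_step[OF assms, of h] J_norm[of h w] by (simp add: mult_left_mono)

text \<open>Both vectors have the same linear part \<open>x + (s + t) *\<^sub>R w\<close>. Replacing
  resolvents of \<open>w\<close> by \<open>w\<close> costs one more application of the operator,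
  hence the second domain condition and the quadratic error.\<close>

lemma J_consistent:
  assumes "(x, w) \<in> B" "(w, v) \<in> B"
  shows "norm (J s (J t x) - J (s + t) x) \<le> 2 * (\<bar>s\<bar> + \<bar>t\<bar>)\<^sup>2 * norm v"
proof -
  let ?m = "\<bar>s\<bar> + \<bar>t\<bar>"
  have n1: "norm (J s (J t w) - w) \<le> ?m * norm v"
  proof -
    have "norm (J s (J t w) - w) \<le> norm (J s (J t w) - J s w) + norm (J s w - w)"
      using norm_triangle_ineq[of "J s (J t w) - J s w" "J s w - w"] by simp
    then show ?thesis
      using J_nonexp[of s "J t w" w] J_near[OF assms(2), of t] J_near[OF assms(2), of s]
      by (simp add: algebra_simps)
  qed
  have n2: "norm (J (s + t) w - w) \<le> ?m * norm v"
    using J_near[OF assms(2), of "s + t"] mult_right_mono[OF abs_triangle_ineq[of s t], of "norm v"] by simp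
  have n3: "norm (J t w - w) \<le> ?m * norm v"
    using J_near[OF assms(2), of t] mult_right_mono[of "\<bar>t\<bar>" ?m "norm v"] by simp
  have "J s (J t x) - J (s + t) x
      = s *\<^sub>R ((J s (J t w) - w) - (J (s + t) w - w)) + t *\<^sub>R ((J t w - w) - (J (s + t) w - w))"
  proof -
    have "J s (J t x) = x + t *\<^sub>R J t w + s *\<^sub>R J s (J t w)"
      using J_step[OF J_graph[OF assms(1)], of s t] J_step[OF assms(1), of t]
      by (simp add: algebra_simps)
    moreover have "J (s + t) x = x + (s + t) *\<^sub>R J (s + t) w"
      using J_step[OF assms(1), of "s + t"] by (simp add: algebra_simps)
    ultimately show ?thesis by (simp add: algebra_simps)
  qed
  also have "norm \<dots> \<le> \<bar>s\<bar> * (2 * (?m * norm v)) + \<bar>t\<bar> * (2 * (?m * norm v))"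
  proof -
    have "norm ((J s (J t w) - w) - (J (s + t) w - w)) \<le> 2 * (?m * norm v)"
      using norm_triangle_ineq4[of "J s (J t w) - w" "J (s + t) w - w"] n1 n2 by linarith
    moreover have "norm ((J t w - w) - (J (s + t) w - w)) \<le> 2 * (?m * norm v)"
      using norm_triangle_ineq4[of "J t w - w" "J (s + t) w - w"] n3 n2 by linarith
    ultimately show ?thesis
      by (intro norm_triangle_le add_mono) (auto intro!: mult_left_mono)
  qed
  also have "\<dots> = 2 * ?m\<^sup>2 * norm v" by (simp add: power2_eq_square algebra_simps)
  finally show ?thesis .
qed

end

section \<open>The generated one-parameter group\<close>

definition nonexpansive :: "('a::real_normed_vector \<Rightarrow> 'a) \<Rightarrow> bool" where
  "nonexpansive P \<longleftrightarrow> (\<forall>x y. norm (P x - P y) \<le> norm (x - y))"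

lemma nonexpansiveD: "nonexpansive P \<Longrightarrow> norm (P x - P y) \<le> norm (x - y)"
  by (simp add: nonexpansive_def)

lemma nonexpansive_comp: "nonexpansive P \<Longrightarrow> nonexpansive Q \<Longrightarrow> nonexpansive (P \<circ> Q)"
  by (simp add: nonexpansive_def) (meson order_trans)

lemma nonexpansive_funpow: "nonexpansive P \<Longrightarrow> nonexpansive (P ^^ n)"
  by (induction n) (simp_all add: nonexpansive_comp nonexpansive_def[of id])

text \<open>The common Lipschitz constant 1 lets map and argument converge simultaneously; limits of
  composed Euler products are taken this way.\<close>

lemma nonexpansive_tendsto:
  assumes "\<And>n. nonexpansive (P n)" "(\<lambda>n. P n y) \<longlonglongrightarrow> z" "x \<longlonglongrightarrow> y"
  shows "(\<lambda>n. P n (x n)) \<longlonglongrightarrow> z"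
proof -
  have "(\<lambda>n. norm (x n - y)) \<longlonglongrightarrow> 0"
    using assms(3) by (simp add: LIM_zero tendsto_norm_zero)
  then have "(\<lambda>n. P n (x n) - P n y) \<longlonglongrightarrow> 0"
    by (rule Lim_null_comparison[rotated]) (simp add: assms(1) nonexpansiveD)
  from tendsto_add[OF this assms(2)] show ?thesis by simp
qed

lemma nonexpansive_isCont: "nonexpansive P \<Longrightarrow> isCont P x"
  unfolding continuous_at_eps_delta nonexpansive_def
  by (auto simp: dist_norm norm_minus_commute intro: order_le_less_trans)

lemma norm_triangle3: "norm (a - b + c) \<le> norm a + norm b + norm c"
  using norm_triangle_ineq[of "a - b" c] norm_triangle_ineq4[of a b] by linarith

text \<open>Three-epsilon argument: replacing \<open>z\<close> by a nearby point of \<open>S\<close>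
  costs the same small amount for every \<open>n\<close>.\<close>

lemma nonexpansive_Cauchy_closure:
  assumes "\<And>n. nonexpansive (P n)" "\<And>x. x \<in> S \<Longrightarrow> Cauchy (\<lambda>n. P n x)" "z \<in> closure S"
  shows "Cauchy (\<lambda>n. P n z)"
proof (rule CauchyI)
  fix e :: real assume "e > 0"
  then obtain x where x: "x \<in> S" "norm (x - z) < e / 3"
    using assms(3) closure_approachable[of z S] by (auto simp: dist_norm dest!: spec[of _ "e / 3"])
  obtain M where M: "\<And>m n. m \<ge> M \<Longrightarrow> n \<ge> M \<Longrightarrow> norm (P m x - P n x) < e / 3"
    using CauchyD[OF assms(2)[OF x(1)], of "e / 3"] \<open>e > 0\<close> by auto
  have "norm (P m z - P n z) < e" if "m \<ge> M" "n \<ge> M" for m n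
  proof -
    have "P m z - P n z = (P m x - P n x) - (P m x - P m z) + (P n x - P n z)" by simp
    also have "norm \<dots> \<le> norm (P m x - P n x) + norm (P m x - P m z) + norm (P n x - P n z)"
      by (rule norm_triangle3)
    finally show ?thesis
      using nonexpansiveD[OF assms(1), of m x z] nonexpansiveD[OF assms(1), of n x z] M[OF that] x(2)
      by linarith
  qed
  then show "\<exists>M. \<forall>m\<ge>M. \<forall>n\<ge>M. norm (P m z - P n z) < e" by blast
qed

lemma isCont_eq_on_dense:
  fixes P Q :: "'a::real_normed_vector \<Rightarrow> 'b::real_normed_vector"
  assumes "\<And>x. isCont P x" "\<And>x. isCont Q x" "\<And>x. x \<in> S \<Longrightarrow> P x = Q x" "closure S = UNIV"
  shows "P = Q"
proof -
  have "closed {x. P x = Q x}"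
    by (intro closed_Collect_eq) (simp_all add: assms(1,2) continuous_at_imp_continuous_on)
  then have "closure S \<subseteq> {x. P x = Q x}" by (intro closure_minimal) (use assms(3) in auto)
  then show ?thesis using assms(4) by auto
qed

lemma funpow_comp_commute:
  assumes "P \<circ> Q = Q \<circ> P"
  shows "(P \<circ> Q) ^^ n = (P ^^ n) \<circ> (Q ^^ n)"
proof (induction n)
  case (Suc n)
  have PQ: "Q (P x) = P (Q x)" for x using assms by (simp add: fun_eq_iff)
  have "Q ((P ^^ n) x) = (P ^^ n) (Q x)" for n x
    by (induction n) (simp_all add: PQ)
  then show ?case using Suc by (simp add: fun_eq_iff)
qed simp

text \<open>Telescoping, where commutation moves every one-step difference back to the starting
  point. The one-step error therefore enters only at \<open>x\<close>, where the domain conditions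
  are known, and not along its orbit.\<close>

lemma nonexpansive_funpow_diff:
  assumes P: "nonexpansive P" and Q: "nonexpansive Q" and comm: "P \<circ> Q = Q \<circ> P"
  shows "norm ((P ^^ n) x - (Q ^^ n) x) \<le> n * norm (P x - Q x)"
proof (induction n)
  case (Suc n)
  have c: "P ((Q ^^ n) x) = (Q ^^ n) (P x)"
  proof (induction n)
    case (Suc n)
    have "P (Q y) = Q (P y)" for y using comm by (simp add: fun_eq_iff)
    then show ?case using Suc by simp
  qed simp
  have "(P ^^ Suc n) x - (Q ^^ Suc n) x
      = (P ((P ^^ n) x) - P ((Q ^^ n) x)) + ((Q ^^ n) (P x) - (Q ^^ n) (Q x))"
    by (simp add: c funpow_swap1)
  also have "norm \<dots> \<le> norm ((P ^^ n) x - (Q ^^ n) x) + norm (P x - Q x)"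
    by (intro norm_triangle_le add_mono nonexpansiveD P nonexpansive_funpow Q)
  finally show ?case using Suc by (simp add: algebra_simps)
qed simp

lemma Cauchy_geometric_steps:
  fixes a :: "nat \<Rightarrow> 'a::real_normed_vector"
  assumes "\<And>n. norm (a (Suc n) - a n) \<le> c / 2 ^ n"
  shows "Cauchy a"
proof -
  have c: "c \<ge> 0" using order_trans[OF norm_ge_zero assms[of 0]] by simp
  \<comment> \<open>The subtracted term makes the bound the exact sum of \<open>c / 2 ^ j\<close>
    for \<open>j\<close> from \<open>n\<close> to \<open>n + k - 1\<close>, so that the induction
    closes.\<close>
  have s: "norm (a (n + k) - a n) \<le> c * 2 / 2 ^ n - c * 2 / 2 ^ (n + k)" for n k
  proof (induction k)
    case (Suc k)
    have "norm (a (n + Suc k) - a n) \<le> norm (a (Suc (n + k)) - a (n + k)) + norm (a (n + k) - a n)"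
      using norm_triangle_ineq[of "a (Suc (n + k)) - a (n + k)" "a (n + k) - a n"] by simp
    also have "\<dots> \<le> c / 2 ^ (n + k) + (c * 2 / 2 ^ n - c * 2 / 2 ^ (n + k))"
      by (intro add_mono assms Suc)
    also have "\<dots> = c * 2 / 2 ^ n - c * 2 / 2 ^ (n + Suc k)" by (simp add: field_simps)
    finally show ?case .
  qed simp
  have s': "norm (a (n + k) - a n) \<le> c * 2 / 2 ^ n" for n k
  proof -
    have "0 \<le> c * 2 / 2 ^ (n + k)" using c by simp
    then show ?thesis using s[of n k] by linarith
  qed
  show ?thesis
  proof (rule CauchyI)
    fix e :: real assume "e > 0"
    have "(\<lambda>n. c * 2 * (1 / 2) ^ n) \<longlonglongrightarrow> c * 2 * 0"
      by (intro tendsto_intros) simp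
    then have "\<forall>\<^sub>F n in sequentially. c * 2 * (1 / 2) ^ n < e / 2"
      by (rule order_tendstoD(2)) (use \<open>e > 0\<close> in simp)
    then obtain M where M: "c * 2 / 2 ^ M < e / 2"
      by (auto simp: eventually_sequentially power_divide)
    have "norm (a m - a n) < e" if "m \<ge> M" "n \<ge> M" for m n
    proof -
      have "norm (a m - a M) \<le> c * 2 / 2 ^ M" "norm (a n - a M) \<le> c * 2 / 2 ^ M"
        using s'[of M "m - M"] s'[of M "n - M"] that by simp_all
      then show ?thesis using M norm_triangle_ineq4[of "a m - a M" "a n - a M"] by simp
    qed
    then show "\<exists>M. \<forall>m\<ge>M. \<forall>n\<ge>M. norm (a m - a n) < e" by blast
  qed
qed

context skew_adjoint
begin

section \<open>Backward Euler products\<close>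

lemma J_nonexpansive: "nonexpansive (J h)"
  by (simp add: nonexpansive_def J_nonexp)

lemma J_comp_commute: "J h \<circ> J k = J k \<circ> J h"
  by (auto simp: J_commute)

text \<open>Backward steps are everywhere defined contractions, whereas forward steps would apply
  the unbounded operator itself at each stage.\<close>

definition euler :: "nat \<Rightarrow> real \<Rightarrow> 'a \<Rightarrow> 'a" where
  "euler n t = J (t / 2 ^ n) ^^ (2 ^ n)"

lemma euler_nonexpansive: "nonexpansive (euler n t)"
  by (simp add: euler_def nonexpansive_funpow J_nonexpansive)

lemma euler_add_scale: "euler n t (x + y) = euler n t x + euler n t y" "euler n t (c *\<^sub>R x) = c *\<^sub>R euler n t x"
proof -
  have "(J h ^^ k) (x + y) = (J h ^^ k) x + (J h ^^ k) y" for h k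
    by (induction k) (simp_all add: J_add)
  moreover have "(J h ^^ k) (c *\<^sub>R x) = c *\<^sub>R (J h ^^ k) x" for h k
    by (induction k) (simp_all add: J_scale)
  ultimately show "euler n t (x + y) = euler n t x + euler n t y" "euler n t (c *\<^sub>R x) = c *\<^sub>R euler n t x"
    by (simp_all add: euler_def)
qed

text \<open>Each of the 2^n steps contributes a local error of order 4^(-n), by
  \<open>J_consistent\<close>.\<close>

lemma euler_product:
  assumes "(x, w) \<in> B" "(w, v) \<in> B"
  shows "norm (euler n s (euler n t x) - euler n (s + t) x) \<le> (2 * (\<bar>s\<bar> + \<bar>t\<bar>)\<^sup>2 * norm v) / 2 ^ n"
proof -
  let ?N = "2 ^ n :: nat"
  have e: "euler n s (euler n t x) = ((J (s / 2 ^ n) \<circ> J (t / 2 ^ n)) ^^ ?N) x"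
    by (simp add: euler_def funpow_comp_commute[OF J_comp_commute])
  have "norm (((J (s / 2 ^ n) \<circ> J (t / 2 ^ n)) ^^ ?N) x - (J ((s + t) / 2 ^ n) ^^ ?N) x)
     \<le> real ?N * norm ((J (s / 2 ^ n) \<circ> J (t / 2 ^ n)) x - J ((s + t) / 2 ^ n) x)"
    by (intro nonexpansive_funpow_diff nonexpansive_comp J_nonexpansive) (auto simp: J_commute)
  also have "\<dots> \<le> real ?N * (2 * (\<bar>s / 2 ^ n\<bar> + \<bar>t / 2 ^ n\<bar>)\<^sup>2 * norm v)"
    using J_consistent[OF assms, of "s / 2 ^ n" "t / 2 ^ n"]
    by (intro mult_left_mono) (simp_all add: add_divide_distrib)
  also have "\<dots> = (2 * (\<bar>s\<bar> + \<bar>t\<bar>)\<^sup>2 * norm v) / 2 ^ n"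
    by (simp add: abs_divide add_divide_distrib[symmetric] power2_eq_square)
  finally show ?thesis unfolding e by (simp add: euler_def)
qed

lemma euler_refine:
  assumes "(x, w) \<in> B" "(w, v) \<in> B"
  shows "norm (euler (Suc n) t x - euler n t x) \<le> (2 * t\<^sup>2 * norm v) / 2 ^ n"
proof -
  let ?N = "2 ^ n :: nat" and ?P = "J (t / 2 ^ Suc n)"
  \<comment> \<open>Two half steps for each of the \<open>2 ^ n\<close> old steps, so that both
    products have the same number of factors.\<close>
  have "euler (Suc n) t = (?P ^^ 2) ^^ ?N"
    by (simp only: euler_def funpow_mult power_Suc)
  then have e: "euler (Suc n) t = (?P \<circ> ?P) ^^ ?N" by (simp add: numeral_2_eq_2)
  have "norm (((?P \<circ> ?P) ^^ ?N) x - (J (t / 2 ^ n) ^^ ?N) x)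
      \<le> real ?N * norm ((?P \<circ> ?P) x - J (t / 2 ^ n) x)"
    by (intro nonexpansive_funpow_diff nonexpansive_comp J_nonexpansive) (auto simp: J_commute)
  also have "\<dots> \<le> real ?N * (2 * (\<bar>t / 2 ^ Suc n\<bar> + \<bar>t / 2 ^ Suc n\<bar>)\<^sup>2 * norm v)"
    using J_consistent[OF assms, of "t / 2 ^ Suc n" "t / 2 ^ Suc n"]
    by (intro mult_left_mono) simp_all
  also have "\<dots> = (2 * t\<^sup>2 * norm v) / 2 ^ n"
    by (simp add: abs_divide power2_eq_square)
  finally show ?thesis by (simp add: e) (simp add: euler_def)
qed

text \<open>The domain of the squared operator, on which \<open>J_consistent\<close>
  applies.\<close>

definition square_domain :: "'a set" where
  "square_domain = {x. \<exists>w v. (x, w) \<in> B \<and> (w, v) \<in> B}"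

lemma domain_approx:
  assumes "e > 0"
  shows "\<exists>x w. (x, w) \<in> B \<and> norm (x - y) < e"
proof -
  have "\<exists>x\<in>fst ` B. dist x y < e"
    using dense assms closure_approachable[of y "fst ` B"] by simp
  then show ?thesis by (auto simp: dist_norm)
qed

text \<open>On the domain the distance is at most \<open>h\<close> times the norm of the operator
  value; density and nonexpansiveness extend the limit to every vector.\<close>

lemma J_tendsto: "((\<lambda>n. J (inverse (real (Suc n))) y)) \<longlonglongrightarrow> y"
proof -
  have "\<exists>M. \<forall>n\<ge>M. norm (J (inverse (real (Suc n))) y - y) < e" if e: "e > 0" for e
  proof -
    obtain x w where xw: "(x, w) \<in> B" "norm (x - y) < e / 4"
      using domain_approx[of "e / 4" y] e by auto
    have "(\<lambda>n. inverse (real (Suc n)) * norm w) \<longlonglongrightarrow> 0 * norm w"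
      by (intro tendsto_intros LIMSEQ_inverse_real_of_nat)
    then have "\<forall>\<^sub>F n in sequentially. inverse (real (Suc n)) * norm w < e / 4"
      by (rule order_tendstoD(2)) (use that in simp)
    then obtain M where M: "\<And>n. n \<ge> M \<Longrightarrow> inverse (real (Suc n)) * norm w < e / 4"
      by (auto simp: eventually_sequentially)
    have "norm (J (inverse (real (Suc n))) y - y) < e" if "n \<ge> M" for n
    proof -
      let ?h = "inverse (real (Suc n))"
      have "J ?h y - y = (J ?h x - x) - (J ?h x - J ?h y) + (x - y)" by simp
      also have "norm \<dots> \<le> norm (J ?h x - x) + norm (J ?h x - J ?h y) + norm (x - y)"
        by (rule norm_triangle3)
      finally show ?thesis
        using J_near[OF xw(1), of ?h] M[OF that] J_nonexp[of ?h x y] xw(2) e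
        by simp
    qed
    then show ?thesis by blast
  qed
  then show ?thesis by (simp add: LIMSEQ_iff)
qed

text \<open>Each resolvent gains one application of the operator, so two of them map any vector into
  \<open>square_domain\<close>, and they tend to the identity as \<open>h\<close> tends to
  0.\<close>

lemma square_domain_dense: "closure square_domain = UNIV"
proof -
  have "y \<in> closure square_domain" for y
  proof -
    let ?h = "\<lambda>n. inverse (real (Suc n))"
    have h: "?h n \<noteq> 0" for n by simp
    have "J (?h n) (J (?h n) y) \<in> square_domain" for n
    proof -
      obtain w where w: "(J (?h n) y, w) \<in> B" "y = J (?h n) y - ?h n *\<^sub>R w" by (rule J_obtain[OF h])
      obtain v where v: "(J (?h n) w, v) \<in> B" "w = J (?h n) w - ?h n *\<^sub>R v" by (rule J_obtain[OF h])
      show ?thesis unfolding square_domain_def using J_graph[OF w(1)] v(1) by blast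
    qed
    moreover have "(\<lambda>n. J (?h n) (J (?h n) y)) \<longlonglongrightarrow> y"
      by (rule nonexpansive_tendsto[OF J_nonexpansive J_tendsto J_tendsto])
    ultimately show ?thesis
      unfolding closure_sequential by (intro exI[of _ "\<lambda>n. J (?h n) (J (?h n) y)"]) auto
  qed
  then show ?thesis by auto
qed

section \<open>The limit and its group law\<close>

definition U :: "real \<Rightarrow> 'a \<Rightarrow> 'a" where
  "U t x = lim (\<lambda>n. euler n t x)"

lemma euler_tendsto: "(\<lambda>n. euler n t x) \<longlonglongrightarrow> U t x"
proof -
  have "Cauchy (\<lambda>n. euler n t x)"
  proof (rule nonexpansive_Cauchy_closure[where S = square_domain])
    fix x assume "x \<in> square_domain"
    then obtain w v where "(x, w) \<in> B" "(w, v) \<in> B" unfolding square_domain_def by blast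
    from euler_refine[OF this] show "Cauchy (\<lambda>n. euler n t x)" by (rule Cauchy_geometric_steps)
  qed (simp_all add: euler_nonexpansive square_domain_dense)
  then show ?thesis unfolding U_def convergent_LIMSEQ_iff[symmetric] by (rule Cauchy_convergent)
qed

lemma U_eqI: "(\<lambda>n. euler n t x) \<longlonglongrightarrow> y \<Longrightarrow> U t x = y"
  by (rule LIMSEQ_unique[OF euler_tendsto])

lemma U_add: "U t (x + y) = U t x + U t y"
  by (rule U_eqI) (unfold euler_add_scale(1), rule tendsto_add[OF euler_tendsto euler_tendsto])

lemma U_scale: "U t (c *\<^sub>R x) = c *\<^sub>R U t x"
  by (rule U_eqI) (unfold euler_add_scale(2), rule tendsto_scaleR[OF tendsto_const euler_tendsto])

lemma U_zero: "U 0 = id"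
  by (rule ext, rule U_eqI) (simp add: euler_def)

lemma U_nonexpansive: "nonexpansive (U t)"
  unfolding nonexpansive_def
proof (intro allI)
  fix x y
  have "(\<lambda>n. norm (euler n t x - euler n t y)) \<longlonglongrightarrow> norm (U t x - U t y)"
    by (intro tendsto_intros euler_tendsto)
  then show "norm (U t x - U t y) \<le> norm (x - y)"
    by (rule LIMSEQ_le_const2) (blast intro: nonexpansiveD[OF euler_nonexpansive])
qed

lemma U_group: "U (s + t) = U s \<circ> U t"
proof -
  have "U (s + t) x = (U s \<circ> U t) x" if x: "x \<in> square_domain" for x
  proof -
    obtain w v where wv: "(x, w) \<in> B" "(w, v) \<in> B" using x unfolding square_domain_def by blast
    have "(\<lambda>n. 2 * (\<bar>s\<bar> + \<bar>t\<bar>)\<^sup>2 * norm v * (1 / 2) ^ n) \<longlonglongrightarrow> 2 * (\<bar>s\<bar> + \<bar>t\<bar>)\<^sup>2 * norm v * 0"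
      by (intro tendsto_intros) simp
    then have "(\<lambda>n. (2 * (\<bar>s\<bar> + \<bar>t\<bar>)\<^sup>2 * norm v) / 2 ^ n) \<longlonglongrightarrow> 0"
      by (simp add: power_divide)
    then have "(\<lambda>n. euler n s (euler n t x) - euler n (s + t) x) \<longlonglongrightarrow> 0"
      by (rule Lim_null_comparison[rotated]) (auto intro!: always_eventually euler_product wv)
    from tendsto_add[OF this euler_tendsto[of "s + t" x]]
    have "(\<lambda>n. euler n s (euler n t x)) \<longlonglongrightarrow> U (s + t) x" by simp
    moreover have "(\<lambda>n. euler n s (euler n t x)) \<longlonglongrightarrow> U s (U t x)"
      by (rule nonexpansive_tendsto[OF euler_nonexpansive euler_tendsto euler_tendsto])
    ultimately show ?thesis using LIMSEQ_unique by fastforce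
  qed
  then show ?thesis
    by (rule isCont_eq_on_dense[OF nonexpansive_isCont[OF U_nonexpansive]
          nonexpansive_isCont[OF nonexpansive_comp[OF U_nonexpansive U_nonexpansive]] _ square_domain_dense])
qed

lemma U_inverse: "U t (U (- t) x) = x" "U (- t) (U t x) = x"
  using U_group[of t "- t"] U_group[of "- t" t] by (simp_all add: U_zero fun_eq_iff)

text \<open>Contractions with contractive inverses are isometric, and time reversal supplies the
  inverse.\<close>

lemma U_norm: "norm (U t x) = norm x"
proof (rule antisym)
  have c: "norm (U s y) \<le> norm y" for s y
    using nonexpansiveD[OF U_nonexpansive, of s y 0] U_scale[of s 0 0] by simp
  show "norm (U t x) \<le> norm x" by (rule c)
  show "norm x \<le> norm (U t x)" using c[of "- t" "U t x"] by (simp add: U_inverse)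
qed

lemma U_bij: "bij (U t)"
  by (rule o_bij[of "U (- t)"]) (auto simp: U_inverse)

section \<open>The generator of the limit group\<close>

lemma J_funpow_near:
  assumes "(x, w) \<in> B"
  shows "norm ((J h ^^ k) x - x) \<le> k * (\<bar>h\<bar> * norm w)"
proof -
  have "norm ((J h ^^ k) x - (id ^^ k) x) \<le> k * norm (J h x - id x)"
    by (rule nonexpansive_funpow_diff[OF J_nonexpansive]) (simp_all add: nonexpansive_def)
  also have "\<dots> \<le> k * (\<bar>h\<bar> * norm w)"
    using J_near[OF assms, of h] by (intro mult_left_mono) simp_all
  finally show ?thesis by (simp add: id_funpow)
qed

lemma U_near:
  assumes "(x, w) \<in> B"
  shows "norm (U t x - x) \<le> \<bar>t\<bar> * norm w"
proof (rule LIMSEQ_le_const2[OF tendsto_norm[OF tendsto_diff[OF euler_tendsto tendsto_const]]])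
  have "norm (euler n t x - x) \<le> \<bar>t\<bar> * norm w" for n
    using J_funpow_near[OF assms, where h = "t / 2 ^ n" and k = "2 ^ n"] by (simp add: euler_def abs_divide)
  then show "\<exists>N. \<forall>n\<ge>N. norm (euler n t x - x) \<le> \<bar>t\<bar> * norm w" by blast
qed

lemma U_continuous_at_0: "((\<lambda>t. U t x) \<longlongrightarrow> x) (at 0)"
proof (rule tendstoI)
  fix e :: real assume "e > 0"
  obtain y w where yw: "(y, w) \<in> B" "norm (y - x) < e / 3"
    using domain_approx[of "e / 3" x] \<open>e > 0\<close> by auto
  have "((\<lambda>t::real. \<bar>t\<bar> * norm w) \<longlongrightarrow> \<bar>0\<bar> * norm w) (at 0)"
    by (intro tendsto_intros)
  then have "\<forall>\<^sub>F t in at 0. \<bar>t\<bar> * norm w < e / 3"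
    by (rule order_tendstoD(2)) (use \<open>e > 0\<close> in simp)
  then show "\<forall>\<^sub>F t in at 0. dist (U t x) x < e"
  proof eventually_elim
    case (elim t)
    have "U t x - x = (U t y - y) - (U t y - U t x) + (y - x)" by simp
    also have "norm \<dots> \<le> norm (U t y - y) + norm (U t y - U t x) + norm (y - x)"
      by (rule norm_triangle3)
    finally show ?case
      using U_near[OF yw(1), of t] elim nonexpansiveD[OF U_nonexpansive, of t y x] yw(2)
      by (simp add: dist_norm)
  qed
qed

lemma J_funpow_graph: "(x, w) \<in> B \<Longrightarrow> ((J h ^^ k) x, (J h ^^ k) w) \<in> B"
  by (induction k) (simp_all add: J_graph)

text \<open>Since \<open>w\<close> need not lie in the domain, its displacement under the powers is
  estimated through a nearby \<open>w'\<close> that does. The term with \<open>w - w'\<close>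
  becomes small by the choice of \<open>w'\<close>, the other one carries a further factor
  \<open>k * \<bar>h\<bar>\<close>.\<close>

lemma J_funpow_linearise:
  assumes "(x, w) \<in> B" "(w', v') \<in> B"
  shows "norm ((J h ^^ k) x - x - (k * h) *\<^sub>R w) \<le> k * \<bar>h\<bar> * (2 * norm (w - w') + k * \<bar>h\<bar> * norm v')"
proof -
  have near: "norm ((J h ^^ m) w - w) \<le> 2 * norm (w - w') + k * \<bar>h\<bar> * norm v'" if "m \<le> k" for m
  proof -
    have "(J h ^^ m) w - w = ((J h ^^ m) w' - w') - ((J h ^^ m) w' - (J h ^^ m) w) + (w' - w)" by simp
    also have "norm \<dots> \<le> norm ((J h ^^ m) w' - w') + norm ((J h ^^ m) w' - (J h ^^ m) w) + norm (w' - w)"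
      by (rule norm_triangle3)
    also have "\<dots> \<le> m * (\<bar>h\<bar> * norm v') + norm (w - w') + norm (w - w')"
      using J_funpow_near[OF assms(2), where h = h and k = m]
        nonexpansiveD[OF nonexpansive_funpow[OF J_nonexpansive[of h], of m], of w' w]
      by (simp add: norm_minus_commute)
    also have "m * (\<bar>h\<bar> * norm v') \<le> k * (\<bar>h\<bar> * norm v')"
      using that by (intro mult_right_mono) simp_all
    finally show ?thesis by simp
  qed
  define M where "M = 2 * norm (w - w') + k * \<bar>h\<bar> * norm v'"
  have "norm ((J h ^^ m) x - x - (m * h) *\<^sub>R w) \<le> m * \<bar>h\<bar> * M" if "m \<le> k" for m
    using that
  proof (induction m)
    case (Suc m)
    have "(J h ^^ Suc m) x - (J h ^^ m) x = h *\<^sub>R (J h ^^ Suc m) w"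
      using J_step[OF J_funpow_graph[OF assms(1), where h = h and k = m], of h] by simp
    then have "(J h ^^ Suc m) x - x - (Suc m * h) *\<^sub>R w
        = ((J h ^^ m) x - x - (m * h) *\<^sub>R w) + h *\<^sub>R ((J h ^^ Suc m) w - w)"
      by (simp add: algebra_simps)
    also have "norm \<dots> \<le> m * \<bar>h\<bar> * M + \<bar>h\<bar> * M"
      using Suc near[of "Suc m"] unfolding M_def[symmetric]
      by (intro norm_triangle_le add_mono) (auto intro!: mult_left_mono)
    finally show ?case by (simp add: algebra_simps)
  qed simp
  from this[of k] show ?thesis by (simp add: M_def)
qed

lemma U_linearise:
  assumes "(x, w) \<in> B" "(w', v') \<in> B"
  shows "norm (U t x - x - t *\<^sub>R w) \<le> \<bar>t\<bar> * (2 * norm (w - w') + \<bar>t\<bar> * norm v')"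
proof (rule LIMSEQ_le_const2)
  show "(\<lambda>n. norm (euler n t x - x - t *\<^sub>R w)) \<longlonglongrightarrow> norm (U t x - x - t *\<^sub>R w)"
    by (intro tendsto_intros euler_tendsto)
  have "norm (euler n t x - x - t *\<^sub>R w) \<le> \<bar>t\<bar> * (2 * norm (w - w') + \<bar>t\<bar> * norm v')" for n
    using J_funpow_linearise[OF assms, where h = "t / 2 ^ n" and k = "2 ^ n"] by (simp add: euler_def abs_divide)
  then show "\<exists>N. \<forall>n\<ge>N. norm (euler n t x - x - t *\<^sub>R w) \<le> \<bar>t\<bar> * (2 * norm (w - w') + \<bar>t\<bar> * norm v')"
    by blast
qed

lemma U_derivative:
  assumes "(x, w) \<in> B"
  shows "((\<lambda>t. U t x) has_vector_derivative w) (at 0)"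
  unfolding has_vector_derivative_def has_derivative_at
proof (intro conjI bounded_linear_scaleR_left)
  have "((\<lambda>t. norm (U t x - x - t *\<^sub>R w) / norm t) \<longlongrightarrow> 0) (at 0)"
  proof (rule tendstoI)
    fix e :: real assume "e > 0"
    \<comment> \<open>First \<open>w'\<close> is fixed, then \<open>t\<close> is restricted; the
      bound becomes \<open>2 * (e / 4) + e / 4\<close>.\<close>
    obtain w' v' where w': "(w', v') \<in> B" "norm (w - w') < e / 4"
      using domain_approx[of "e / 4" w] \<open>e > 0\<close> by (auto simp: norm_minus_commute)
    have "((\<lambda>t::real. \<bar>t\<bar> * norm v') \<longlongrightarrow> \<bar>0\<bar> * norm v') (at 0)"
      by (intro tendsto_intros)
    then have "\<forall>\<^sub>F t in at 0. \<bar>t\<bar> * norm v' < e / 4"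
      by (rule order_tendstoD(2)) (use \<open>e > 0\<close> in simp)
    moreover have "\<forall>\<^sub>F t in at (0::real). t \<noteq> 0" by (simp add: eventually_at_filter)
    ultimately show "\<forall>\<^sub>F t in at 0. dist (norm (U t x - x - t *\<^sub>R w) / norm t) 0 < e"
    proof eventually_elim
      case (elim t)
      have "norm (U t x - x - t *\<^sub>R w) / \<bar>t\<bar> \<le> 2 * norm (w - w') + \<bar>t\<bar> * norm v'"
        using U_linearise[OF assms w'(1), of t] elim(2) by (simp add: divide_le_eq mult.commute)
      also have "\<dots> < e" using w'(2) elim(1) \<open>e > 0\<close> by simp
      finally show ?case by simp
    qed
  qed
  then show "((\<lambda>h. norm (U (0 + h) x - U 0 x - h *\<^sub>R w) / norm h) \<longlongrightarrow> 0) (at 0)"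
    by (simp add: U_zero)
qed

lemma U_inner: "inner (U t x) y = inner x (U (- t) y)"
proof -
  have "inner (U t a) (U t b) = inner a b" for a b
    using U_norm[of t "a + b"] U_norm[of t a] U_norm[of t b] by (simp add: dot_norm U_add)
  from this[of x "U (- t) y"] show ?thesis by (simp add: U_inverse)
qed

text \<open>Differentiating \<open>inner (U t a) x = inner a (U (- t) x)\<close> at 0 shows that any
  derivative \<open>y\<close> satisfies the condition defining membership in \<open>B\<close>; by
  maximality the generator is not a proper extension of \<open>B\<close>.\<close>

lemma U_derivative_iff: "((\<lambda>t. U t x) has_vector_derivative y) (at 0) \<longleftrightarrow> (x, y) \<in> B"
proof
  assume d: "((\<lambda>t. U t x) has_vector_derivative y) (at 0)"
  show "(x, y) \<in> B"
    unfolding adj[of x]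
  proof (intro allI impI)
    fix a w assume aw: "(a, w) \<in> B"
    have "((\<lambda>t. U (- t) x) has_vector_derivative - y) (at 0)"
    proof -
      have "((\<lambda>t. - t) has_vector_derivative - 1) (at (0::real))" 
        by (auto intro!: derivative_eq_intros)
      from vector_diff_chain_at[OF this, of "\<lambda>t. U t x" y] show ?thesis using d by (simp add: o_def)
    qed
    then have "((\<lambda>t. inner a (U (- t) x)) has_vector_derivative inner a (- y)) (at 0)"
      by (rule bounded_linear.has_vector_derivative[OF bounded_linear_inner_right])
    moreover have "((\<lambda>t. inner (U t a) x) has_vector_derivative inner w x) (at 0)"
      by (rule bounded_linear.has_vector_derivative[OF bounded_linear_inner_left U_derivative[OF aw]])
    ultimately have "inner w x = inner a (- y)"
      by (simp only: U_inner) (rule vector_derivative_unique_at)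
    then show "inner w x = - inner a y" by simp
  qed
qed (rule U_derivative)

lemma U_continuous: "continuous_on UNIV (\<lambda>t. U t x)"
proof (rule continuous_at_imp_continuous_on, intro ballI)
  fix t
  have "((\<lambda>h. U t (U h x)) \<longlongrightarrow> U t x) (at 0)"
    by (rule isCont_tendsto_compose[OF nonexpansive_isCont[OF U_nonexpansive] U_continuous_at_0])
  then show "isCont (\<lambda>t. U t x) t"
    unfolding isCont_iff by (simp add: U_group)
qed

end

section \<open>Stone's theorem and transport of exponentials\<close>

text \<open>Commutation passes from the graph to the resolvents, to their powers and to the limit.
  For multiplication by i it makes the group complex linear.\<close>

lemma (in skew_adjoint) U_commute:
  assumes T: "bounded_linear T" and graph: "\<And>x w. (x, w) \<in> B \<Longrightarrow> (T x, T w) \<in> B"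
  shows "U t (T x) = T (U t x)"
proof (rule U_eqI)
  interpret T: bounded_linear T by fact
  have J: "J h (T y) = T (J h y)" for h y
  proof (cases "h = 0")
    case False
    obtain w where w: "(J h y, w) \<in> B" "y = J h y - h *\<^sub>R w" by (rule J_obtain[OF False])
    have "J h (T (J h y) - h *\<^sub>R T w) = T (J h y)" by (rule J_eq) (rule graph[OF w(1)])
    moreover have "T (J h y) - h *\<^sub>R T w = T y"
      by (subst (2) w(2)) (simp add: T.diff T.scaleR)
    ultimately show ?thesis by simp
  qed simp
  have "(J h ^^ k) (T y) = T ((J h ^^ k) y)" for h k y
    by (induction k) (simp_all add: J)
  then have "euler n t (T x) = T (euler n t x)" for n by (simp add: euler_def)
  then show "(\<lambda>n. euler n t (T x)) \<longlonglongrightarrow> T (U t x)" by (simp add: T.tendsto euler_tendsto)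
qed

lemma closure_image_inverse:
  assumes "continuous_on UNIV \<phi>" "continuous_on UNIV \<psi>" "\<And>x. \<psi> (\<phi> x) = x" "\<And>x. \<phi> (\<psi> x) = x"
  shows "closure (\<phi> ` S) = \<phi> ` closure S"
proof
  show "\<phi> ` closure S \<subseteq> closure (\<phi> ` S)"
    using assms(1) by (intro image_closure_subset closed_closure closure_subset) (auto intro: continuous_on_subset)
  have "\<psi> ` closure (\<phi> ` S) \<subseteq> closure (\<psi> ` \<phi> ` S)"
    using assms(2) by (intro image_closure_subset closed_closure closure_subset) (auto intro: continuous_on_subset)
  also have "\<psi> ` \<phi> ` S = S" by (force simp: assms)
  finally show "closure (\<phi> ` S) \<subseteq> \<phi> ` closure S" using assms(4) by (metis image_subset_iff image_eqI subsetI)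
qed

lemma op_closure_domain_dense:
  assumes "closure D = UNIV" shows "closure (fst ` op_closure D A) = UNIV"
proof -
  have "D \<subseteq> fst ` graph_on D A" by (force simp: graph_on_def)
  also have "\<dots> \<subseteq> fst ` op_closure D A" unfolding op_closure_def by (intro image_mono closure_subset)
  finally show ?thesis using closure_mono assms by blast
qed

section \<open>Complex structure and self-adjoint graphs\<close>

lemma complex_structureD:
  assumes "complex_structure sc"
  shows sc_of_real: "sc (complex_of_real r) x = r *\<^sub>R x"
    and sc_mult: "sc (a * b) x = sc a (sc b x)"
    and sc_add_left: "sc (a + b) x = sc a x + sc b x"
    and sc_add: "sc a (x + y) = sc a x + sc a y"
    and sc_inner: "inner (sc \<i> x) (sc \<i> y) = inner x y"
  using assms by (auto simp: complex_structure_def)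

context
  fixes sc :: "complex \<Rightarrow> 'h::{real_inner,complete_space} \<Rightarrow> 'h"
  assumes cs: "complex_structure sc"
begin

lemma sc_scaleR: "sc a (r *\<^sub>R x) = r *\<^sub>R sc a x"
  using sc_mult[OF cs, of a "complex_of_real r" x] sc_mult[OF cs, of "complex_of_real r" a x]
  by (simp add: sc_of_real[OF cs] mult.commute)

lemma sc_i_i: "sc \<i> (sc \<i> x) = - x"
  using sc_mult[OF cs, of \<i> \<i> x] sc_of_real[OF cs, of "-1" x] by simp

lemma sc_decompose: "sc c x = Re c *\<^sub>R x + Im c *\<^sub>R sc \<i> x"
proof -
  have "sc c x = sc (complex_of_real (Re c) + complex_of_real (Im c) * \<i>) x"
    by (simp add: complex_eq[of c, symmetric] mult.commute)
  then show ?thesis by (simp only: sc_add_left[OF cs] sc_mult[OF cs] sc_of_real[OF cs])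
qed

lemma sc_i_bounded_linear: "bounded_linear (sc \<i>)"
proof (rule bounded_linear_intro[where K = 1])
  show "norm (sc \<i> x) \<le> norm x * 1" for x
    using sc_inner[OF cs, of x x] by (simp add: norm_eq_sqrt_inner)
qed (simp_all add: sc_add[OF cs] sc_scaleR)

lemma sc_inner_left: "inner (sc \<i> x) y = - inner x (sc \<i> y)"
  using sc_inner[OF cs, of x "sc \<i> y"] by (simp add: sc_i_i)

lemma sc_diff: "sc a (x - y) = sc a x - sc a y"
  using sc_add[OF cs, of a "x - y" y] by simp

text \<open>Equality of complex pairings means two real equations, which multiplication by i
  exchanges. An adjoint graph is invariant under i, so a single one of them characterises
  membership, and it expresses skew-adjointness of i times the operator.\<close>

lemma self_adjoint_skew_adjoint:
  assumes sa: "self_adjoint sc G" and dense: "closure (fst ` G) = UNIV"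
  shows "skew_adjoint {(x, sc \<i> y) | x y. (x, y) \<in> G}" (is "skew_adjoint ?B")
    and "\<And>x w. (x, w) \<in> G \<Longrightarrow> (sc \<i> x, sc \<i> w) \<in> G"
proof -
  have G: "(y, z) \<in> G \<longleftrightarrow> (\<forall>x w. (x, w) \<in> G \<longrightarrow> inner w y = inner x z \<and> inner (sc \<i> w) y = inner (sc \<i> x) z)"
    for y z
  proof -
    have "(y, z) \<in> G \<longleftrightarrow> (y, z) \<in> adjoint_graph sc G" using sa by (simp add: self_adjoint_def)
    then show ?thesis by (auto simp: adjoint_graph_def cinner_def)
  qed
  show i: "(sc \<i> x, sc \<i> w) \<in> G" if "(x, w) \<in> G" for x w
    unfolding G[of "sc \<i> x"]
  proof (intro allI impI conjI)
    fix a b assume "(a, b) \<in> G"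
    then have "inner b x = inner a w" "inner (sc \<i> b) x = inner (sc \<i> a) w" using G that by blast+
    then show "inner b (sc \<i> x) = inner a (sc \<i> w)" "inner (sc \<i> b) (sc \<i> x) = inner (sc \<i> a) (sc \<i> w)"
      by (simp_all add: sc_inner[OF cs] sc_inner_left sc_i_i)
  qed
  show "skew_adjoint ?B"
  proof
    have "fst ` ?B = fst ` G" by force
    then show "closure (fst ` ?B) = UNIV" using dense by simp
    fix y z
    have "(y, z) \<in> ?B \<longleftrightarrow> (y, - sc \<i> z) \<in> G"
    proof
      assume "(y, z) \<in> ?B"
      then show "(y, - sc \<i> z) \<in> G" by (auto simp: sc_i_i)
    next
      assume *: "(y, - sc \<i> z) \<in> G"
      have "z = sc \<i> (- sc \<i> z)" using sc_diff[of \<i> 0 "sc \<i> z"] sc_scaleR[of \<i> 0 0] by (simp add: sc_i_i)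
      then show "(y, z) \<in> ?B" using * by blast
    qed
    also have "\<dots> \<longleftrightarrow> (\<forall>x w. (x, w) \<in> G \<longrightarrow> inner (sc \<i> w) y = - inner x z)"
    proof -
      have "inner (sc \<i> w) y = inner (sc \<i> x) (- sc \<i> z) \<longleftrightarrow> inner (sc \<i> w) y = - inner x z" for x w
        by (simp add: sc_inner[OF cs])
      \<comment> \<open>The other real pairing is the hypothesis at the graph point
        \<open>(sc \<i> x, sc \<i> w)\<close>.\<close>
      moreover have "inner w y = inner x (- sc \<i> z)"
        if all: "\<forall>x w. (x, w) \<in> G \<longrightarrow> inner (sc \<i> w) y = - inner x z" and "(x, w) \<in> G" for x w
      proof -
        have "inner (sc \<i> (sc \<i> w)) y = - inner (sc \<i> x) z" using all i[OF that(2)] by blast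
        then show ?thesis by (simp add: sc_i_i sc_inner_left)
      qed
      ultimately show ?thesis unfolding G[of y] by blast
    qed
    also have "\<dots> \<longleftrightarrow> (\<forall>x w. (x, w) \<in> ?B \<longrightarrow> inner w y = - inner x z)" by blast
    finally show "(y, z) \<in> ?B \<longleftrightarrow> (\<forall>x w. (x, w) \<in> ?B \<longrightarrow> inner w y = - inner x z)" .
  qed
qed

theorem Stone_existence:
  assumes sa: "self_adjoint sc G" and dense: "closure (fst ` G) = UNIV"
  shows "\<exists>U. unitary_group_of sc U G"
proof -
  interpret skew_adjoint "{(x, sc \<i> y) | x y. (x, y) \<in> G}"
    by (rule self_adjoint_skew_adjoint[OF assms])
  have "U t (sc \<i> x) = sc \<i> (U t x)" for t x
    by (rule U_commute[OF sc_i_bounded_linear]) (use self_adjoint_skew_adjoint(2)[OF assms] in blast)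
  then have sc: "U t (sc c x) = sc c (U t x)" for t c x
    by (simp add: sc_decompose[of c] U_add U_scale)
  have inj: "sc \<i> y = sc \<i> y' \<longleftrightarrow> y = y'" for y y'
    by (metis sc_i_i neg_equal_iff_equal)
  have "((\<lambda>t. U t x) has_vector_derivative sc \<i> y) (at 0) \<longleftrightarrow> (x, y) \<in> G" for x y
    unfolding U_derivative_iff by (auto simp: inj)
  then have "unitary_group_of sc U G"
    unfolding unitary_group_of_def unitary_def
    by (auto simp: U_add sc U_bij U_norm U_zero U_group U_continuous)
  then show ?thesis by blast
qed

section \<open>Unitary maps and uniqueness of the generated group\<close>

lemma unitary_bounded_linear:
  assumes "unitary sc T" shows "bounded_linear T"
proof (rule bounded_linear_intro[where K = 1])
  fix r x
  have "T (sc (complex_of_real r) x) = sc (complex_of_real r) (T x)" using assms by (simp add: unitary_def)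
  then show "T (r *\<^sub>R x) = r *\<^sub>R T x" by (simp add: sc_of_real[OF cs])
qed (use assms in \<open>simp_all add: unitary_def\<close>)

lemma unitary_inv:
  assumes "unitary sc T" shows "unitary sc (inv T)"
proof -
  have b: "bij T" using assms by (simp add: unitary_def)
  then have TT: "T (inv T x) = x" "inv T (T x) = x" for x
    by (simp_all add: bij_is_surj surj_f_inv_f bij_is_inj)
  have "inv T (x + y) = inv T x + inv T y" for x y
    using assms TT unfolding unitary_def by metis
  moreover have "inv T (sc c x) = sc c (inv T x)" for c x
    using assms TT unfolding unitary_def by metis
  moreover have "norm (inv T x) = norm x" for x
    using assms TT unfolding unitary_def by metis
  ultimately show ?thesis unfolding unitary_def using b by (simp add: bij_imp_bij_inv)
qed

lemma unitary_comp: "unitary sc S \<Longrightarrow> unitary sc T \<Longrightarrow> unitary sc (S \<circ> T)"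
  by (simp add: unitary_def bij_comp)

text \<open>The group law shifts differentiation at \<open>t\<close> to differentiation at 0, where
  \<open>G\<close> is characterised.\<close>

lemma unitary_group_orbit:
  assumes U: "unitary_group_of sc U G" and "(x, y) \<in> G"
  shows "(U t x, U t y) \<in> G"
    and "((\<lambda>s. U s x) has_vector_derivative sc \<i> (U t y)) (at t)"
proof -
  have u: "unitary sc (U t)" using U by (simp add: unitary_group_of_def)
  have add: "U (a + b) z = U a (U b z)" for a b z using U by (simp add: unitary_group_of_def)
  have swap: "U t (U s z) = U s (U t z)" for s z by (metis add add.commute)
  have "((\<lambda>s. U s x) has_vector_derivative sc \<i> y) (at 0)"
    using assms by (simp add: unitary_group_of_def)
  then have "((\<lambda>s. U t (U s x)) has_vector_derivative U t (sc \<i> y)) (at 0)"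
    by (rule bounded_linear.has_vector_derivative[OF unitary_bounded_linear[OF u]])
  then have d: "((\<lambda>s. U t (U s x)) has_vector_derivative sc \<i> (U t y)) (at 0)"
    using u by (simp add: unitary_def)
  then show "(U t x, U t y) \<in> G"
    using U by (simp add: unitary_group_of_def swap)
  have "((\<lambda>s. s - t) has_vector_derivative 1) (at t)"
    by (auto intro!: derivative_eq_intros)
  from vector_diff_chain_at[OF this, of "\<lambda>s. U t (U s x)" "sc \<i> (U t y)"] d
  show "((\<lambda>s. U s x) has_vector_derivative sc \<i> (U t y)) (at t)"
    by (simp add: o_def add[symmetric])
qed

text \<open>Conservation of the norm, differentiated at 0.\<close>

lemma unitary_group_symmetric:
  assumes U: "unitary_group_of sc U G" and "(x, y) \<in> G"
  shows "inner x (sc \<i> y) = 0"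
proof -
  have d: "((\<lambda>s. U s x) has_vector_derivative sc \<i> y) (at 0)"
    using assms by (simp add: unitary_group_of_def)
  have "((\<lambda>s. inner (U s x) (U s x)) has_vector_derivative inner (U 0 x) (sc \<i> y) + inner (sc \<i> y) (U 0 x)) (at 0)"
    by (rule bounded_bilinear.has_vector_derivative[OF bounded_bilinear_inner d d])
  moreover have "(\<lambda>s. inner (U s x) (U s x)) = (\<lambda>s. inner x x)"
    using U by (auto simp: unitary_group_of_def unitary_def power2_norm_eq_inner[symmetric])
  ultimately have "inner (U 0 x) (sc \<i> y) + inner (sc \<i> y) (U 0 x) = 0"
    using vector_derivative_unique_at has_vector_derivative_const by metis
  then show ?thesis using U by (simp add: unitary_group_of_def inner_commute)
qed

text \<open>For \<open>x\<close> in the domain, the squared distance between the two orbits has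
  derivative 0 by \<open>unitary_group_symmetric\<close>, and the orbits start together. Density of
  the domain does the rest.\<close>

lemma unitary_group_unique:
  assumes U: "unitary_group_of sc U G" and V: "unitary_group_of sc V G"
    and dense: "closure (fst ` G) = UNIV"
  shows "U = V"
proof
  fix t
  have eq: "U t x = V t x" if x: "x \<in> fst ` G" for x
  proof -
    obtain y where xy: "(x, y) \<in> G" using x by auto
    define g where "g = (\<lambda>s. U s x - V s x)"
    have diff: "(a - b, c - d) \<in> G" if "(a, c) \<in> G" "(b, d) \<in> G" for a b c d
    proof -
      have "((\<lambda>s. U s a - U s b) has_vector_derivative sc \<i> c - sc \<i> d) (at 0)"
        using that U by (intro has_vector_derivative_diff) (simp_all add: unitary_group_of_def)
      moreover have "U s a - U s b = U s (a - b)" for s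
        using unitary_bounded_linear[of "U s"] U
        by (simp add: unitary_group_of_def bounded_linear.linear linear_diff)
      ultimately show ?thesis using U by (simp add: unitary_group_of_def sc_diff)
    qed
    have "((\<lambda>s. inner (g s) (g s)) has_vector_derivative 0) (at s)" for s
    proof -
      have d: "(g has_vector_derivative sc \<i> (U s y - V s y)) (at s)"
        unfolding g_def sc_diff by (intro has_vector_derivative_diff unitary_group_orbit(2)[OF _ xy] U V)
      have "inner (g s) (sc \<i> (U s y - V s y)) = 0"
        unfolding g_def by (intro unitary_group_symmetric[OF U] diff unitary_group_orbit(1)[OF _ xy] U V)
      then show ?thesis
        using bounded_bilinear.has_vector_derivative[OF bounded_bilinear_inner d d] by (simp add: inner_commute)
    qed
    then have "inner (g t) (g t) = inner (g 0) (g 0)"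
      by (intro DERIV_isconst_all[rule_format]) (simp add: has_real_derivative_iff_has_vector_derivative)
    also have "g 0 = 0" using U V by (simp add: g_def unitary_group_of_def)
    finally show ?thesis by (simp add: g_def)
  qed
  have "isCont (U t) x" "isCont (V t) x" for x
    using U V by (auto intro!: linear_continuous_at unitary_bounded_linear simp: unitary_group_of_def)
  then show "U t = V t" using eq dense by (rule isCont_eq_on_dense)
qed

text \<open>Uniqueness resolves the definite description in \<open>uexp\<close>: exhibiting one
  group with generator \<open>G\<close> identifies the exponential. Rescaling and conjugation of
  exponentials are obtained in this way.\<close>

lemma uexp_eqI:
  assumes "unitary_group_of sc U G" "closure (fst ` G) = UNIV"
  shows "uexp sc G = U"
  unfolding uexp_def using assms by (auto intro!: the_equality unitary_group_unique)

lemma uexp_unitary_group: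
  assumes "self_adjoint sc G" "closure (fst ` G) = UNIV"
  shows "unitary_group_of sc (uexp sc G) G"
  using Stone_existence[OF assms] uexp_eqI[OF _ assms(2)] by metis

section \<open>Transport of exponentials\<close>

lemma unitary_group_rescale:
  assumes U: "unitary_group_of sc U G" and c: "c \<noteq> 0"
  shows "unitary_group_of sc (\<lambda>t. U (c * t)) ((\<lambda>(x, y). (x, c *\<^sub>R y)) ` G)"
proof -
  have chain: "((\<lambda>t. g (a * t)) has_vector_derivative a *\<^sub>R z) (at 0)"
    if "(g has_vector_derivative z) (at 0)" for a :: real and g and z :: 'h
  proof -
    have "((\<lambda>t. a * t) has_vector_derivative a) (at 0)" by (auto intro!: derivative_eq_intros)
    from vector_diff_chain_at[OF this, of g z] that show ?thesis by (simp add: o_def)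
  qed
  have "(x, y) \<in> (\<lambda>(x, y). (x, c *\<^sub>R y)) ` G \<longleftrightarrow>
      ((\<lambda>t. U (c * t) x) has_vector_derivative sc \<i> y) (at 0)" for x y
  proof -
    have "(x, y) \<in> (\<lambda>(x, y). (x, c *\<^sub>R y)) ` G \<longleftrightarrow> (x, inverse c *\<^sub>R y) \<in> G"
      using c by force
    also have "\<dots> \<longleftrightarrow> ((\<lambda>t. U t x) has_vector_derivative inverse c *\<^sub>R sc \<i> y) (at 0)"
      using U by (simp add: unitary_group_of_def sc_scaleR)
    \<comment> \<open>The time change by \<open>c\<close> proves one direction, the change back by
      \<open>inverse c\<close> the other.\<close>
    also have "\<dots> \<longleftrightarrow> ((\<lambda>t. U (c * t) x) has_vector_derivative sc \<i> y) (at 0)"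
      using chain[of "\<lambda>t. U t x" "inverse c *\<^sub>R sc \<i> y" c]
        chain[of "\<lambda>t. U (c * t) x" "sc \<i> y" "inverse c"] c
      by (auto simp: mult.assoc[symmetric])
    finally show ?thesis .
  qed
  moreover have "continuous_on UNIV (\<lambda>t. U (c * t) x)" for x
  proof -
    have "continuous_on UNIV (\<lambda>t. U t x)" using U by (simp add: unitary_group_of_def)
    from continuous_on_compose2[OF this, of UNIV "\<lambda>t. c * t"] show ?thesis
      by (simp add: continuous_intros)
  qed
  ultimately show ?thesis
    using U by (simp add: unitary_group_of_def distrib_left)
qed

lemma unitary_group_conj:
  assumes U: "unitary_group_of sc U G" and T: "unitary sc T"
  shows "unitary_group_of sc (\<lambda>t. T \<circ> U t \<circ> inv T) ((\<lambda>(x, y). (T x, T y)) ` G)"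
proof -
  have b: "bij T" using T by (simp add: unitary_def)
  then have TT: "T (inv T x) = x" "inv T (T x) = x" for x
    by (simp_all add: bij_is_surj surj_f_inv_f bij_is_inj)
  have lin: "bounded_linear T" "bounded_linear (inv T)"
    using T by (auto intro: unitary_bounded_linear unitary_inv)
  have "(x, y) \<in> (\<lambda>(x, y). (T x, T y)) ` G \<longleftrightarrow>
      ((\<lambda>t. (T \<circ> U t \<circ> inv T) x) has_vector_derivative sc \<i> y) (at 0)" for x y
  proof -
    have "(x, y) \<in> (\<lambda>(x, y). (T x, T y)) ` G \<longleftrightarrow> (inv T x, inv T y) \<in> G"
    proof
      assume "(inv T x, inv T y) \<in> G"
      then have "(T (inv T x), T (inv T y)) \<in> (\<lambda>(x, y). (T x, T y)) ` G" by (auto intro!: image_eqI)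
      then show "(x, y) \<in> (\<lambda>(x, y). (T x, T y)) ` G" by (simp add: TT)
    qed (auto simp: TT)
    also have "\<dots> \<longleftrightarrow> ((\<lambda>t. U t (inv T x)) has_vector_derivative inv T (sc \<i> y)) (at 0)"
      using U unitary_inv[OF T] by (simp add: unitary_group_of_def unitary_def)
    also have "\<dots> \<longleftrightarrow> ((\<lambda>t. T (U t (inv T x))) has_vector_derivative sc \<i> y) (at 0)"
      using bounded_linear.has_vector_derivative[OF lin(1), of "\<lambda>t. U t (inv T x)" "inv T (sc \<i> y)"]
        bounded_linear.has_vector_derivative[OF lin(2), of "\<lambda>t. T (U t (inv T x))" "sc \<i> y"]
      by (auto simp: TT)
    finally show ?thesis by simp
  qed
  moreover have "continuous_on UNIV (\<lambda>t. T (U t (inv T x)))" for x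
    using U by (intro bounded_linear.continuous_on[OF lin(1)]) (simp add: unitary_group_of_def)
  ultimately show ?thesis
    using U T unitary_inv[OF T] TT
    by (simp add: unitary_group_of_def unitary_comp fun_eq_iff)
qed

lemma ess_self_adjoint_uexp:
  assumes "ess_self_adjoint sc D A" "closure D = UNIV"
  shows "unitary_group_of sc (uexp sc (op_closure D A)) (op_closure D A)"
  using assms(1) unfolding ess_self_adjoint_def
  by (rule uexp_unitary_group[OF _ op_closure_domain_dense[OF assms(2)]])

text \<open>For nonzero \<open>c\<close>, scaling the second coordinate is a homeomorphism and
  commutes with closing the graph. The factor -1 gives time reversal; a general factor trades time
  against the size of the test function.\<close>

lemma uexp_rescale:
  assumes "ess_self_adjoint sc D A" "closure D = UNIV" "c \<noteq> 0" "\<And>x. x \<in> D \<Longrightarrow> A' x = c *\<^sub>R A x"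
  shows "uexp sc (op_closure D A') t = uexp sc (op_closure D A) (c * t)"
proof -
  let ?\<phi> = "\<lambda>(x, y). (x, c *\<^sub>R y) :: 'h \<times> 'h"
  have "graph_on D A' = ?\<phi> ` graph_on D A" using assms(4) by (auto simp: graph_on_def image_iff)
  moreover have "closure (?\<phi> ` graph_on D A) = ?\<phi> ` closure (graph_on D A)"
    using assms(3)
    by (intro closure_image_inverse[where \<psi> = "\<lambda>(x, y). (x, inverse c *\<^sub>R y)"])
      (auto simp: split_beta intro!: continuous_intros)
  ultimately have "op_closure D A' = ?\<phi> ` op_closure D A" by (simp add: op_closure_def)
  then have "unitary_group_of sc (\<lambda>t. uexp sc (op_closure D A) (c * t)) (op_closure D A')"
    using unitary_group_rescale[OF ess_self_adjoint_uexp[OF assms(1,2)] assms(3)] by simp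
  then show ?thesis using uexp_eqI op_closure_domain_dense[OF assms(2)] by metis
qed

text \<open>As \<open>T\<close> maps \<open>D\<close> onto itself, the graph of \<open>A'\<close> is
  the full image of the graph of \<open>A\<close> under a homeomorphism, and this persists for the
  closures.\<close>

lemma uexp_conj:
  assumes "ess_self_adjoint sc D A" "closure D = UNIV" "unitary sc T" "T ` D = D"
    and "\<And>x. x \<in> D \<Longrightarrow> A' (T x) = T (A x)"
  shows "uexp sc (op_closure D A') t = T \<circ> uexp sc (op_closure D A) t \<circ> inv T"
proof -
  let ?\<phi> = "\<lambda>(x, y). (T x, T y)"
  have b: "bij T" using assms(3) by (simp add: unitary_def)
  then have TT: "T (inv T x) = x" "inv T (T x) = x" for x
    by (simp_all add: bij_is_surj surj_f_inv_f bij_is_inj)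
  have lin: "bounded_linear T" "bounded_linear (inv T)"
    using assms(3) by (auto intro: unitary_bounded_linear unitary_inv)
  have "graph_on D A' = {(T x, A' (T x)) | x. x \<in> D}"
    unfolding graph_on_def by (subst assms(4)[symmetric]) blast
  also have "\<dots> = ?\<phi> ` graph_on D A"
    using assms(5) by (auto simp: graph_on_def image_iff)
  finally have "graph_on D A' = ?\<phi> ` graph_on D A" .
  moreover have "closure (?\<phi> ` graph_on D A) = ?\<phi> ` closure (graph_on D A)"
    by (intro closure_image_inverse[where \<psi> = "\<lambda>(x, y). (inv T x, inv T y)"])
      (auto simp: split_beta TT intro!: continuous_intros bounded_linear.continuous_on[OF lin(1)]
        bounded_linear.continuous_on[OF lin(2)])
  ultimately have "op_closure D A' = ?\<phi> ` op_closure D A" by (simp add: op_closure_def)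
  then have "unitary_group_of sc (\<lambda>t. T \<circ> uexp sc (op_closure D A) t \<circ> inv T) (op_closure D A')"
    using unitary_group_conj[OF ess_self_adjoint_uexp[OF assms(1,2)] assms(3)] by simp
  then show ?thesis using uexp_eqI op_closure_domain_dense[OF assms(2)] by metis
qed

end

section \<open>Minkowski geometry and the Poincare group\<close>

text \<open>Kept in the type \<open>pt\<close> with time component 0, so that the Euclidean norm and
  the Cauchy-Schwarz inequality of that type apply to spatial parts.\<close>

definition space_part :: "pt \<Rightarrow> pt" where
  "space_part x = x - x$1 *\<^sub>R axis 1 1"

lemma inner_pt: "inner x y = x$1 * y$1 + x$2 * y$2 + x$3 * y$3 + x$4 * y$4" for x y :: pt
  by (simp add: inner_vec_def sum_4)

lemma axis1_component [simp]: "(axis 1 1 :: pt) $ 1 = 1" "(axis 1 1 :: pt) $ 2 = 0"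
    "(axis 1 1 :: pt) $ 3 = 0" "(axis 1 1 :: pt) $ 4 = 0"
  by (simp_all add: axis_def)

lemma space_part_component [simp]: "space_part x $ 1 = 0" "space_part x $ 2 = x$2"
    "space_part x $ 3 = x$3" "space_part x $ 4 = x$4"
  by (simp_all add: space_part_def)

lemma spatial_norm_eq: "spatial_norm x = norm (space_part x)"
  by (simp add: spatial_norm_def norm_eq_sqrt_inner inner_pt power2_eq_square)

lemma mink_eq: "mink x y = x$1 * y$1 - inner (space_part x) (space_part y)"
  by (simp add: mink_def inner_pt)

lemma spatial_norm_add: "spatial_norm (x + y) \<le> spatial_norm x + spatial_norm y"
proof -
  have "space_part (x + y) = space_part x + space_part y" by (simp add: space_part_def algebra_simps)
  then show ?thesis by (simp add: spatial_norm_eq norm_triangle_ineq)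
qed

lemma spatial_norm_scale: "spatial_norm (c *\<^sub>R x) = \<bar>c\<bar> * spatial_norm x"
proof -
  have "space_part (c *\<^sub>R x) = c *\<^sub>R space_part x" by (simp add: space_part_def algebra_simps)
  then show ?thesis by (simp add: spatial_norm_eq)
qed

lemma spatial_norm_minus [simp]: "spatial_norm (- x) = spatial_norm x"
  using spatial_norm_scale[of "-1" x] by simp

lemma spatial_norm_nonneg: "0 \<le> spatial_norm x"
  by (simp add: spatial_norm_eq)

lemma spatial_norm_time [simp]: "spatial_norm (c *\<^sub>R axis 1 1) = 0"
  by (simp add: spatial_norm_def)

lemma spatial_norm_continuous [continuous_intros]:
  "continuous_on S f \<Longrightarrow> continuous_on S (\<lambda>x. spatial_norm (f x))"
  unfolding spatial_norm_eq space_part_def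
  by (intro continuous_intros) (auto intro!: continuous_intros)

section \<open>Light cones\<close>

definition timelike_cone :: "pt set" where
  "timelike_cone = {p. spatial_norm p < p$1}"

lemma forward_cone_add: "x \<in> forward_cone \<Longrightarrow> y \<in> forward_cone \<Longrightarrow> x + y \<in> forward_cone"
  using spatial_norm_add[of x y] by (simp add: forward_cone_def)

lemma forward_timelike_add: "x \<in> forward_cone \<Longrightarrow> y \<in> timelike_cone \<Longrightarrow> x + y \<in> timelike_cone"
  using spatial_norm_add[of x y] by (simp add: forward_cone_def timelike_cone_def)

lemma timelike_forward: "x \<in> timelike_cone \<Longrightarrow> x \<in> forward_cone"
  by (simp add: forward_cone_def timelike_cone_def)

lemma timelike_scale: "x \<in> timelike_cone \<Longrightarrow> c > 0 \<Longrightarrow> c *\<^sub>R x \<in> timelike_cone"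
  by (simp add: timelike_cone_def spatial_norm_scale)

lemma forward_cone_closed: "closed forward_cone"
  unfolding forward_cone_def by (intro closed_Collect_le continuous_intros)

lemma timelike_cone_open: "open timelike_cone"
  unfolding timelike_cone_def by (intro open_Collect_less continuous_intros)

text \<open>In terms of cones, spacelike separation can be tested by adding vectors, since the cones
  are closed under sums.\<close>

lemma spacelike_iff: "spacelike v \<longleftrightarrow> v \<notin> forward_cone \<and> - v \<notin> forward_cone"
  by (auto simp: spacelike_def forward_cone_def)

text \<open>Cauchy-Schwarz for the spatial parts. It later decides the sign of time components,
  which are products with the time axis.\<close>

lemma mink_forward_nonneg:
  assumes "x \<in> forward_cone" "y \<in> forward_cone" shows "0 \<le> mink x y"
proof -
  have "inner (space_part x) (space_part y) \<le> spatial_norm x * spatial_norm y"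
    unfolding spatial_norm_eq by (rule norm_cauchy_schwarz)
  also have "\<dots> \<le> x$1 * y$1"
    using assms by (intro mult_mono) (auto simp: forward_cone_def spatial_norm_nonneg intro: order_trans[OF spatial_norm_nonneg])
  finally show ?thesis by (simp add: mink_eq)
qed

lemma mink_self: "mink x x = (x$1)\<^sup>2 - (spatial_norm x)\<^sup>2"
  unfolding mink_eq spatial_norm_eq power2_norm_eq_inner by (simp add: power2_eq_square)

lemma mink_self_forward:
  assumes "0 \<le> mink x x" "0 \<le> x$1" shows "x \<in> forward_cone"
proof -
  have "(spatial_norm x)\<^sup>2 \<le> (x$1)\<^sup>2" using assms(1) by (simp add: mink_self)
  then show ?thesis using power2_le_imp_le[OF _ assms(2)] by (simp add: forward_cone_def)
qed

lemma mink_axis1 [simp]: "mink (axis 1 1) x = x$1" "mink x (axis 1 1) = x$1"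
  by (simp_all add: mink_def)

section \<open>The proper orthochronous Lorentz group and the Poincare action\<close>

lemma matrix_inv_inverse:
  assumes "det L \<noteq> (0::real)"
  shows "L ** matrix_inv L = mat 1" "matrix_inv L ** L = mat 1"
proof -
  have "invertible L" using assms by (simp add: invertible_det_nz)
  then have "L ** matrix_inv L = mat 1 \<and> matrix_inv L ** L = mat 1"
    unfolding invertible_def matrix_inv_def by (rule someI_ex)
  then show "L ** matrix_inv L = mat 1" "matrix_inv L ** L = mat 1" by auto
qed

lemma lorentz_inverse:
  assumes "lorentz_po L"
  shows "L *v (matrix_inv L *v x) = x" "matrix_inv L *v (L *v x) = x"
  using matrix_inv_inverse[of L] assms by (simp_all add: lorentz_po_def matrix_vector_mul_assoc)

lemma matrix_vector_axis1: "(L *v axis 1 1) $ 1 = L$1$1" for L :: "real^4^4"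
  by (simp add: matrix_vector_mult_basis column_def)

lemma lorentz_inv:
  assumes L: "lorentz_po L" shows "lorentz_po (matrix_inv L)"
proof -
  have m: "mink (L *v x) (L *v y) = mink x y" for x y using L by (simp add: lorentz_po_def)
  have mi: "mink (matrix_inv L *v x) (matrix_inv L *v y) = mink x y" for x y
    using m[of "matrix_inv L *v x" "matrix_inv L *v y"] by (simp add: lorentz_inverse[OF L])
  have "det (L ** matrix_inv L) = 1" using matrix_inv_inverse[of L] L by (simp add: lorentz_po_def)
  then have "det (matrix_inv L) = 1" using L by (simp add: det_mul lorentz_po_def)
  \<comment> \<open>The time-time entry is the product of the time axis with its image; by
    invariance it is the same for the inverse.\<close>
  moreover have "matrix_inv L $ 1 $ 1 = L $ 1 $ 1"
    using m[of "axis 1 1" "matrix_inv L *v axis 1 1"]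
    by (simp add: lorentz_inverse[OF L] matrix_vector_axis1)
  ultimately show ?thesis using L mi by (simp add: lorentz_po_def)
qed

lemma lorentz_axis_timelike:
  assumes L: "lorentz_po L" shows "L *v axis 1 1 \<in> timelike_cone"
proof -
  have "mink (L *v axis 1 1) (L *v axis 1 1) = 1" "(L *v axis 1 1) $ 1 \<ge> 1"
    using L by (simp_all add: lorentz_po_def matrix_vector_axis1)
  then have "(spatial_norm (L *v axis 1 1))\<^sup>2 < ((L *v axis 1 1) $ 1)\<^sup>2" "0 \<le> (L *v axis 1 1) $ 1"
    by (simp_all add: mink_self)
  then show ?thesis unfolding timelike_cone_def using power2_less_imp_less by blast
qed

text \<open>The time component of \<open>L *v x\<close> is its product with the time axis;
  invariance turns it into the product of the forward vectors
  \<open>matrix_inv L *v axis 1 1\<close> and \<open>x\<close>.\<close>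

lemma lorentz_forward:
  assumes L: "lorentz_po L" and x: "x \<in> forward_cone" shows "L *v x \<in> forward_cone"
proof (rule mink_self_forward)
  show "0 \<le> mink (L *v x) (L *v x)"
    using L mink_forward_nonneg[OF x x] by (simp add: lorentz_po_def)
  have "mink (L *v (matrix_inv L *v axis 1 1)) (L *v x) = mink (matrix_inv L *v axis 1 1) x"
    using L by (simp only: lorentz_po_def)
  then have "(L *v x) $ 1 = mink (matrix_inv L *v axis 1 1) x"
    by (simp add: lorentz_inverse[OF L])
  also have "\<dots> \<ge> 0"
    by (intro mink_forward_nonneg x timelike_forward lorentz_axis_timelike lorentz_inv L)
  finally show "0 \<le> (L *v x) $ 1" .
qed

lemma lorentz_mult:
  assumes L: "lorentz_po L" and M: "lorentz_po M" shows "lorentz_po (L ** M)"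
proof -
  have m: "mink ((L ** M) *v x) ((L ** M) *v y) = mink x y" for x y
    using L M by (simp add: lorentz_po_def matrix_vector_mul_assoc[symmetric])
  let ?e = "(L ** M) *v axis 1 1"
  have "?e \<in> forward_cone"
    unfolding matrix_vector_mul_assoc[symmetric]
    by (intro lorentz_forward L timelike_forward lorentz_axis_timelike M)
  then have pos: "?e $ 1 \<ge> 0" using spatial_norm_nonneg[of ?e] by (simp add: forward_cone_def)
  \<comment> \<open>The image of the time axis has Minkowski square 1, so its time component is at
    least 1 in absolute value; being forward fixes the sign.\<close>
  have "(?e $ 1)\<^sup>2 = 1 + (spatial_norm ?e)\<^sup>2"
    using m[of "axis 1 1" "axis 1 1"] spatial_norm_time[of 1] by (simp add: mink_self)
  then have "1 \<le> (?e $ 1)\<^sup>2" by simp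
  then have "1 \<le> ?e $ 1" using pos power2_le_imp_le[of 1 "?e $ 1"] by simp
  then show ?thesis using L M m by (simp add: lorentz_po_def det_mul matrix_vector_axis1)
qed

lemma pmult_poinc: "p \<in> poinc \<Longrightarrow> q \<in> poinc \<Longrightarrow> pmult p q \<in> poinc"
  by (auto simp: poinc_def pmult_def lorentz_mult)

lemma pinv_poinc: "p \<in> poinc \<Longrightarrow> pinv p \<in> poinc"
  by (auto simp: poinc_def pinv_def lorentz_inv)

lemma translation_poinc: "(mat 1, a) \<in> poinc"
  by (simp add: poinc_def lorentz_po_def) (simp add: mat_def)

lemma pact_pmult: "pact p (pact q x) = pact (pmult p q) x"
  by (simp add: pact_def pmult_def matrix_vector_mul_assoc matrix_vector_right_distrib)

lemma pact_pinv: 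
  assumes "p \<in> poinc" shows "pact p (pact (pinv p) x) = x" "pact (pinv p) (pact p x) = x"
  using assms by (auto simp: pact_def pinv_def poinc_def lorentz_inverse matrix_vector_right_distrib
      matrix_vector_mult_diff_distrib linear_neg[OF matrix_vector_mul_linear])

lemma pmult_pinv:
  assumes "p \<in> poinc" shows "pmult p (pinv p) = pone" "pmult (pinv p) p = pone"
  using assms matrix_inv_inverse[of "fst p"]
  by (auto simp: pmult_def pinv_def pone_def poinc_def lorentz_po_def lorentz_inverse
      matrix_vector_mul_assoc linear_neg[OF matrix_vector_mul_linear])

lemma pact_continuous: "continuous_on S (pact p)"
  unfolding pact_def by (intro continuous_intros linear_continuous_on matrix_vector_mul_bounded_linear)

lemma pact_image_vimage: "p \<in> poinc \<Longrightarrow> pact p ` S = pact (pinv p) -` S"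
  by (force simp: pact_pinv image_iff)

lemma pact_inj: "p \<in> poinc \<Longrightarrow> inj (pact p)"
  by (rule inj_on_inverseI[of _ "pact (pinv p)"]) (simp add: pact_pinv)

lemma open_pact_image: "p \<in> poinc \<Longrightarrow> open S \<Longrightarrow> open (pact p ` S)"
  unfolding pact_image_vimage by (intro open_vimage pact_continuous)

lemma closure_pact_image: "p \<in> poinc \<Longrightarrow> closure (pact p ` S) = pact p ` closure S"
  by (rule closure_image_inverse[where \<psi> = "pact (pinv p)"]) (simp_all add: pact_continuous pact_pinv)

section \<open>Double cones and their separation\<close>

lemma dcones_open: "o1 \<in> dcones \<Longrightarrow> open o1"
proof -
  have "open (dcone0 R)" for R unfolding dcone0_def by (intro open_Collect_less continuous_intros)
  then show "o1 \<in> dcones \<Longrightarrow> open o1" by (auto simp: dcones_def intro: open_pact_image)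
qed

lemma dcones_pact: 
  assumes "p \<in> poinc" "o1 \<in> dcones" shows "pact p ` o1 \<in> dcones"
proof -
  obtain q R where q: "o1 = pact q ` dcone0 R" "q \<in> poinc" "R > 0" using assms(2) by (auto simp: dcones_def)
  then have "pact p ` o1 = pact (pmult p q) ` dcone0 R"
    by (simp add: image_image pact_pmult)
  then show ?thesis using pmult_poinc[OF assms(1) q(2)] q(3) unfolding dcones_def by blast
qed

text \<open>\<open>n\<close> and \<open>m\<close> are the future and past tips of the double cone.\<close>

lemma dcone_tips:
  assumes "o1 \<in> dcones"
  obtains m n where "n - m \<in> timelike_cone"
    "\<And>x. x \<in> closure o1 \<Longrightarrow> n - x \<in> forward_cone" "\<And>x. x \<in> closure o1 \<Longrightarrow> x - m \<in> forward_cone"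
    "\<And>d. 0 < d \<Longrightarrow> d < 1 \<Longrightarrow> n - d *\<^sub>R (n - m) \<in> o1" "\<And>d. 0 < d \<Longrightarrow> d < 1 \<Longrightarrow> m + d *\<^sub>R (n - m) \<in> o1"
proof -
  obtain p R where p: "o1 = pact p ` dcone0 R" "p \<in> poinc" "R > 0" using assms by (auto simp: dcones_def)
  obtain L a where La: "p = (L, a)" by (cases p)
  have L: "lorentz_po L" using p La by (simp add: poinc_def)
  \<comment> \<open>The time axis carried along by \<open>p\<close>; the tips of the double cone are
    \<open>tip R\<close> and \<open>tip (- R)\<close>.\<close>
  define tip where "tip c = pact p (c *\<^sub>R axis 1 1)" for c
  have tip_diff: "tip c - tip d = (c - d) *\<^sub>R (L *v axis 1 1)" for c d
    by (simp add: tip_def pact_def La matrix_vector_mult_scaleR algebra_simps)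
  have tip_in: "tip c \<in> o1" if "\<bar>c\<bar> < R" for c
    using that unfolding tip_def p(1) by (intro imageI) (simp add: dcone0_def)
  have sub: "closure o1 \<subseteq> {x. tip R - x \<in> forward_cone} \<inter> {x. x - tip (- R) \<in> forward_cone}"
  proof (rule closure_minimal)
    show "o1 \<subseteq> {x. tip R - x \<in> forward_cone} \<inter> {x. x - tip (- R) \<in> forward_cone}"
    proof
      fix x assume "x \<in> o1"
      then obtain y where y: "x = pact p y" "\<bar>y$1\<bar> + spatial_norm y < R" by (auto simp: p(1) dcone0_def)
      have "R *\<^sub>R axis 1 1 - y \<in> forward_cone"
        using spatial_norm_add[of "R *\<^sub>R axis 1 1" "- y"] y(2) by (simp add: forward_cone_def)
      moreover have "y + R *\<^sub>R axis 1 1 \<in> forward_cone"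
        using spatial_norm_add[of y "R *\<^sub>R axis 1 1"] y(2) by (simp add: forward_cone_def)
      moreover have "tip R - x = L *v (R *\<^sub>R axis 1 1 - y)" "x - tip (- R) = L *v (y + R *\<^sub>R axis 1 1)"
        by (simp_all add: tip_def y(1) pact_def La matrix_vector_mult_diff_distrib matrix_vector_right_distrib
            linear_neg[OF matrix_vector_mul_linear])
      ultimately show "x \<in> {x. tip R - x \<in> forward_cone} \<inter> {x. x - tip (- R) \<in> forward_cone}"
        using lorentz_forward[OF L] by simp
    qed
    have "closed ((\<lambda>x. tip R - x) -` forward_cone)" "closed ((\<lambda>x. x - tip (- R)) -` forward_cone)"
      by (intro closed_vimage forward_cone_closed continuous_intros)+
    then show "closed ({x. tip R - x \<in> forward_cone} \<inter> {x. x - tip (- R) \<in> forward_cone})"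
      by (simp add: vimage_def closed_Int)
  qed
  show thesis
  proof (rule that[of "tip R" "tip (- R)"])
    show "tip R - tip (- R) \<in> timelike_cone"
      unfolding tip_diff by (rule timelike_scale[OF lorentz_axis_timelike[OF L]]) (use p in simp)
    fix d :: real assume d: "0 < d" "d < 1"
    have in1: "\<bar>R - d * (2 * R)\<bar> < R"
    proof -
      have "0 < d * R" "d * R < R" using d p(3) by simp_all
      then have "- R < R - 2 * (d * R)" "R - 2 * (d * R) < R" by linarith+
      then show ?thesis unfolding abs_less_iff mult.left_commute[of d] by linarith
    qed
    have "tip R - d *\<^sub>R (tip R - tip (- R)) = tip (R - d * (2 * R))"
      using tip_diff[of R "R - d * (2 * R)"] unfolding tip_diff[of R "- R"] by (simp add: algebra_simps)
    then show "tip R - d *\<^sub>R (tip R - tip (- R)) \<in> o1" using tip_in[OF in1] by simp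
    have "tip (- R) + d *\<^sub>R (tip R - tip (- R)) = tip (- (R - d * (2 * R)))"
      using tip_diff[of "- (R - d * (2 * R))" "- R"] unfolding tip_diff[of R "- R"] by (simp add: algebra_simps)
    then show "tip (- R) + d *\<^sub>R (tip R - tip (- R)) \<in> o1" using tip_in[of "- (R - d * (2 * R))"] in1 by simp
  qed (use sub in auto)
qed

lemma timelike_perturb:
  assumes "u \<in> timelike_cone" obtains d where "0 < d" "d < 1" "u - d *\<^sub>R w \<in> timelike_cone"
proof -
  have "((\<lambda>d. u - d *\<^sub>R w) \<longlongrightarrow> u - 0 *\<^sub>R w) (at_right 0)"
    by (intro tendsto_intros)
  then have "\<forall>\<^sub>F d in at_right 0. u - d *\<^sub>R w \<in> timelike_cone"
    using topological_tendstoD[OF _ timelike_cone_open] assms by fastforce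
  moreover have "\<forall>\<^sub>F d in at_right (0::real). d < 1"
    by (rule order_tendstoD(2)[OF tendsto_ident_at]) simp
  moreover have "\<forall>\<^sub>F d in at_right (0::real). 0 < d" by (simp add: eventually_at_right_less)
  ultimately have "\<forall>\<^sub>F d in at_right 0. 0 < d \<and> d < 1 \<and> u - d *\<^sub>R w \<in> timelike_cone"
    by eventually_elim auto
  then have "\<exists>d. 0 < d \<and> d < 1 \<and> u - d *\<^sub>R w \<in> timelike_cone"
    by (rule eventually_happens'[rotated]) simp
  then show ?thesis using that by blast
qed

text \<open>The closures of causally disjoint double cones may touch along a light ray. Pulling the tips
  apart along \<open>u - v\<close>, with \<open>u\<close> and \<open>v\<close> the differences between the future tip of one and the past
  tip of the other cone, separates them: \<open>u\<close>, \<open>v\<close> are not timelike while \<open>u + v\<close> is.\<close>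

lemma perp_separation:
  assumes o1: "o1 \<in> dcones" and o2: "o2 \<in> dcones" and perp: "perp o1 o2"
  obtains a where "\<And>e. e > 0 \<Longrightarrow> perp (pact (mat 1, e *\<^sub>R a) ` closure o1) (closure o2)"
proof -
  obtain m1 n1 where t1: "n1 - m1 \<in> timelike_cone"
    "\<And>x. x \<in> closure o1 \<Longrightarrow> n1 - x \<in> forward_cone" "\<And>x. x \<in> closure o1 \<Longrightarrow> x - m1 \<in> forward_cone"
    "\<And>d. 0 < d \<Longrightarrow> d < 1 \<Longrightarrow> n1 - d *\<^sub>R (n1 - m1) \<in> o1" "\<And>d. 0 < d \<Longrightarrow> d < 1 \<Longrightarrow> m1 + d *\<^sub>R (n1 - m1) \<in> o1"
    using dcone_tips[OF o1] by metis
  obtain m2 n2 where t2: "n2 - m2 \<in> timelike_cone"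
    "\<And>x. x \<in> closure o2 \<Longrightarrow> n2 - x \<in> forward_cone" "\<And>x. x \<in> closure o2 \<Longrightarrow> x - m2 \<in> forward_cone"
    "\<And>d. 0 < d \<Longrightarrow> d < 1 \<Longrightarrow> n2 - d *\<^sub>R (n2 - m2) \<in> o2" "\<And>d. 0 < d \<Longrightarrow> d < 1 \<Longrightarrow> m2 + d *\<^sub>R (n2 - m2) \<in> o2"
    using dcone_tips[OF o2] by metis
  have no: "x - y \<notin> forward_cone \<and> y - x \<notin> forward_cone" if "x \<in> o1" "y \<in> o2" for x y
    using perp that by (force simp: perp_def spacelike_iff)
  define u v where "u = n1 - m2" and "v = n2 - m1"
  let ?w = "(n1 - m1) + (n2 - m2)"
  \<comment> \<open>If \<open>u\<close> were timelike, it would remain so after moving both tips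
    slightly along their axes into the cones, giving points of \<open>o1\<close> and
    \<open>o2\<close> that are not spacelike to each other.\<close>
  have u: "u \<notin> timelike_cone"
  proof
    assume "u \<in> timelike_cone"
    then obtain d where d: "0 < d" "d < 1" "u - d *\<^sub>R ?w \<in> timelike_cone" by (rule timelike_perturb)
    have "u - d *\<^sub>R ?w = (n1 - d *\<^sub>R (n1 - m1)) - (m2 + d *\<^sub>R (n2 - m2))"
      by (simp add: u_def algebra_simps)
    then show False using no[OF t1(4)[OF d(1,2)] t2(5)[OF d(1,2)]] timelike_forward[OF d(3)] by metis
  qed
  have v: "v \<notin> timelike_cone"
  proof
    assume "v \<in> timelike_cone"
    then obtain d where d: "0 < d" "d < 1" "v - d *\<^sub>R ?w \<in> timelike_cone" by (rule timelike_perturb)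
    have "v - d *\<^sub>R ?w = (n2 - d *\<^sub>R (n2 - m2)) - (m1 + d *\<^sub>R (n1 - m1))"
      by (simp add: v_def algebra_simps)
    then show False using no[OF t1(5)[OF d(1,2)] t2(4)[OF d(1,2)]] timelike_forward[OF d(3)] by metis
  qed
  have uv: "u + v \<in> timelike_cone"
  proof -
    have "u + v = ?w" by (simp add: u_def v_def algebra_simps)
    then show ?thesis using forward_timelike_add[OF timelike_forward[OF t1(1)] t2(1)] by simp
  qed
  have scale_imp: "x \<in> timelike_cone" if "e > 0" "(1 + e + e) *\<^sub>R x \<in> timelike_cone" for e x
    using timelike_scale[OF that(2), of "inverse (1 + e + e)"] that(1) by simp
  show thesis
  proof (rule that[of "u - v"])
    fix e :: real assume e: "e > 0"
    have euv: "e *\<^sub>R (u + v) \<in> timelike_cone" using uv e by (rule timelike_scale)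
    have "spacelike (x + e *\<^sub>R (u - v) - y)" if x: "x \<in> closure o1" and y: "y \<in> closure o2" for x y
      unfolding spacelike_iff
    proof (intro conjI notI)
      assume z: "x + e *\<^sub>R (u - v) - y \<in> forward_cone"
      \<comment> \<open>The three forward vectors telescope to
        \<open>u + e *\<^sub>R (u - v)\<close>; adding \<open>e *\<^sub>R (u + v)\<close> leaves a
        positive multiple of \<open>u\<close> alone.\<close>
      have "(n1 - x) + (x + e *\<^sub>R (u - v) - y) + (y - m2) + e *\<^sub>R (u + v) \<in> timelike_cone"
        by (intro forward_timelike_add[OF _ euv] forward_cone_add z t1(2)[OF x] t2(3)[OF y])
      moreover have "(n1 - x) + (x + e *\<^sub>R (u - v) - y) + (y - m2) + e *\<^sub>R (u + v) = (1 + e + e) *\<^sub>R u"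
        by (simp add: u_def vec_eq_iff algebra_simps)
      ultimately show False using scale_imp[OF e] u by simp
    next
      assume z: "- (x + e *\<^sub>R (u - v) - y) \<in> forward_cone"
      have "(n2 - y) + - (x + e *\<^sub>R (u - v) - y) + (x - m1) + e *\<^sub>R (u + v) \<in> timelike_cone"
        by (intro forward_timelike_add[OF _ euv] forward_cone_add z t2(2)[OF y] t1(3)[OF x])
      moreover have "(n2 - y) + - (x + e *\<^sub>R (u - v) - y) + (x - m1) + e *\<^sub>R (u + v) = (1 + e + e) *\<^sub>R v"
        by (simp add: v_def vec_eq_iff algebra_simps)
      ultimately show False using scale_imp[OF e] v by simp
    qed
    then show "perp (pact (mat 1, e *\<^sub>R (u - v)) ` closure o1) (closure o2)"
      by (auto simp: perp_def pact_def)
  qed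
qed

section \<open>Invariance of Lebesgue measure\<close>

lemma distr_lborel_pact:
  assumes p: "p \<in> poinc" shows "distr lborel borel (pact p) = lborel"
proof (rule lborel_eqI[symmetric])
  fix l u :: pt assume lu: "\<And>b. b \<in> Basis \<Longrightarrow> l \<bullet> b \<le> u \<bullet> b"
  obtain L a where q: "pinv p = (L, a)" "lorentz_po L" using pinv_poinc[OF p] by (auto simp: poinc_def)
  have meas: "pact p \<in> borel_measurable borel" by (rule borel_measurable_continuous_onI[OF pact_continuous])
  have box: "box l u \<in> lmeasurable" by simp
  have img: "pact (pinv p) ` box l u = (+) a ` ((*v) L ` box l u)"
    by (simp add: q pact_def image_image add.commute)
  have m: "pact (pinv p) ` box l u \<in> lmeasurable"
    unfolding img by (intro measurable_translation measurable_linear_image matrix_vector_mul_linear box)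
  \<comment> \<open>The preimage of a box under \<open>pact p\<close> is its image under the
    inverse, a translate of a linear image with determinant 1.\<close>
  have "measure lebesgue (pact (pinv p) ` box l u) = measure lebesgue (box l u)"
    unfolding img measure_translation
    using q(2) by (subst measure_linear_image[OF matrix_vector_mul_linear box])
      (simp add: matrix_of_matrix_vector_mul lorentz_po_def)
  then have eq: "emeasure lebesgue (pact (pinv p) ` box l u) = emeasure lebesgue (box l u)"
    using m box by (simp add: emeasure_eq_measure2)
  have v: "pact p -` box l u = pact (pinv p) ` box l u"
    by (force simp: pact_pinv[OF p] image_iff)
  have b: "pact p -` box l u \<in> sets borel"
    using measurable_sets[OF meas, of "box l u"] by simp
  have "emeasure (distr lborel borel (pact p)) (box l u) = emeasure lborel (pact p -` box l u)"
    using meas by (subst emeasure_distr) simp_all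
  also have "\<dots> = emeasure lebesgue (pact (pinv p) ` box l u)"
    using b by (simp add: v)
  also have "\<dots> = emeasure lborel (box l u)" using eq by simp
  finally show "emeasure (distr lborel borel (pact p)) (box l u) = (\<Prod>b\<in>Basis. (u - l) \<bullet> b)"
    using lu by simp
qed simp

lemma set_integral_pact:
  fixes F :: "pt \<Rightarrow> real"
  assumes p: "p \<in> poinc" and S: "S \<in> sets borel" and F: "F \<in> borel_measurable borel"
  shows "(LINT x : pact p ` S | lborel. F x) = (LINT x : S | lborel. F (pact p x))"
proof -
  have meas: "pact q \<in> borel_measurable borel" for q
    by (rule borel_measurable_continuous_onI[OF pact_continuous])
  have S': "pact p ` S \<in> sets borel"
    unfolding pact_image_vimage[OF p] using measurable_sets[OF meas S, of "pinv p"] by simp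
  have "(LINT x : pact p ` S | lborel. F x) = (LINT x | distr lborel borel (pact p). indicator (pact p ` S) x *\<^sub>R F x)"
    unfolding set_lebesgue_integral_def distr_lborel_pact[OF p] ..
  also have "\<dots> = (LINT x | lborel. indicator (pact p ` S) (pact p x) *\<^sub>R F (pact p x))"
    using meas S' F by (intro integral_distr) simp_all
  also have "\<dots> = (LINT x : S | lborel. F (pact p x))"
    unfolding set_lebesgue_integral_def using pact_inj[OF p]
    by (intro Bochner_Integration.integral_cong) (auto simp: indicator_def inj_image_mem_iff)
  finally show ?thesis .
qed

section \<open>Test functions\<close>

lemma smooth_iter_part: "smooth f \<Longrightarrow> continuous_on UNIV (iter_part is f)"
    "smooth f \<Longrightarrow> (\<lambda>h. iter_part is f (x + h *\<^sub>R axis i 1)) differentiable (at 0)"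
  by (auto simp: smooth_def)

lemma dpart_linear:
  assumes "(\<lambda>h. f (x + h *\<^sub>R axis i 1)) differentiable (at 0)" "(\<lambda>h. g (x + h *\<^sub>R axis i 1)) differentiable (at 0)"
  shows "dpart i (\<lambda>y. a * f y + b * g y) x = a * dpart i f x + b * dpart i g x"
  unfolding dpart_def
proof (rule vector_derivative_at)
  show "((\<lambda>h. a * f (x + h *\<^sub>R axis i 1) + b * g (x + h *\<^sub>R axis i 1)) has_vector_derivative
      a * vector_derivative (\<lambda>h. f (x + h *\<^sub>R axis i 1)) (at 0)
    + b * vector_derivative (\<lambda>h. g (x + h *\<^sub>R axis i 1)) (at 0)) (at 0)"
    using assms by (intro has_vector_derivative_add has_vector_derivative_mult_right)
      (auto simp: vector_derivative_works)
qed

lemma iter_part_linear: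
  assumes "smooth f" "smooth g"
  shows "iter_part is (\<lambda>y. a * f y + b * g y) = (\<lambda>y. a * iter_part is f y + b * iter_part is g y)"
proof (induction "is")
  case (Cons i "is")
  then show ?case by (simp add: dpart_linear smooth_iter_part assms)
qed simp

lemma smooth_linear:
  assumes "smooth f" "smooth g" shows "smooth (\<lambda>y. a * f y + b * g y)"
  unfolding smooth_def iter_part_linear[OF assms]
proof (intro allI conjI)
  fix "is" i x
  show "continuous_on UNIV (\<lambda>y. a * iter_part is f y + b * iter_part is g y)"
    by (intro continuous_on_add continuous_on_mult continuous_on_const smooth_iter_part(1) assms)
  show "(\<lambda>h. a * iter_part is f (x + h *\<^sub>R axis i 1) + b * iter_part is g (x + h *\<^sub>R axis i 1))
      differentiable (at 0)"
    by (rule differentiable_add[OF differentiable_mult[OF differentiable_const smooth_iter_part(2)[OF assms(1)]]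
          differentiable_mult[OF differentiable_const smooth_iter_part(2)[OF assms(2)]]])
qed

text \<open>The complement of the support is open, so a lower derivative vanishes on a whole
  neighbourhood of \<open>x\<close>; the induction hypothesis is needed at all nearby
  points.\<close>

lemma iter_part_outside_support:
  assumes "x \<notin> tsupp f" shows "iter_part is f x = 0"
  using assms
proof (induction "is" arbitrary: x)
  case Nil
  then show ?case using closure_subset by (force simp: tsupp_def)
next
  case (Cons i "is")
  have "((\<lambda>h. x + h *\<^sub>R axis i 1) \<longlongrightarrow> x + 0 *\<^sub>R axis i 1) (at (0::real))" by (intro tendsto_intros)
  then have "\<forall>\<^sub>F h in at (0::real). x + h *\<^sub>R axis i 1 \<in> - tsupp f"
    using topological_tendstoD[of _ _ _ "- tsupp f"] Cons.prems by (fastforce simp: tsupp_def)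
  then have "\<forall>\<^sub>F h in nhds (0::real). x + h *\<^sub>R axis i 1 \<in> - tsupp f"
    using Cons.prems by (simp add: eventually_nhds_conv_at)
  then have ev: "\<forall>\<^sub>F h in nhds (0::real). iter_part is f (x + h *\<^sub>R axis i 1) = 0"
    by eventually_elim (simp add: Cons.IH)
  have "vector_derivative (\<lambda>h. iter_part is f (x + h *\<^sub>R axis i 1)) (at 0) = 0"
  proof (rule vector_derivative_at)
    show "((\<lambda>h. iter_part is f (x + h *\<^sub>R axis i 1)) has_vector_derivative 0) (at 0)"
      using ev eventually_nhds_x_imp_x[OF ev]
      by (subst has_vector_derivative_cong_ev[where g = "\<lambda>_. 0" and S = UNIV])
        (auto elim: eventually_mono)
  qed
  then show ?case by (simp add: dpart_def)
qed

lemma schwartz_compact_support: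
  assumes f: "smooth f" and K: "compact (tsupp f)" shows "schwartz f"
  unfolding schwartz_def
proof (intro conjI allI f)
  fix "is" :: "4 list" and k :: nat
  let ?F = "\<lambda>x. (1 + norm x) ^ k * norm (iter_part is f x)"
  have "continuous_on (tsupp f) ?F"
    by (intro continuous_intros continuous_on_subset[OF smooth_iter_part(1)[OF f]]) simp
  then have "bounded (?F ` tsupp f)" by (intro compact_imp_bounded compact_continuous_image K)
  then have "bounded (insert 0 (?F ` tsupp f))" by simp
  moreover have "range ?F \<subseteq> insert 0 (?F ` tsupp f)"
  proof
    fix y assume "y \<in> range ?F"
    then obtain x where "y = ?F x" by blast
    then show "y \<in> insert 0 (?F ` tsupp f)"
      by (cases "x \<in> tsupp f") (simp_all add: iter_part_outside_support)
  qed
  ultimately show "bounded (range ?F)" by (rule bounded_subset)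
qed

lemma test_fun_continuous:
  assumes "test_fun a g" shows "continuous_on UNIV g"
proof -
  have "continuous_on UNIV (\<lambda>x. complex_of_real (g x))"
    using assms smooth_iter_part(1)[of "\<lambda>x. complex_of_real (g x)" "[]"]
    unfolding test_fun_def iter_part.simps by blast
  from continuous_on_Re[OF this] show ?thesis by simp
qed

lemma test_fun_linear:
  assumes f: "test_fun a f" and g: "test_fun a g"
  shows "test_fun a (\<lambda>x. c * f x + d * g x)"
proof -
  let ?h = "\<lambda>x. c * f x + d * g x"
  have "smooth (\<lambda>x. complex_of_real (?h x))"
    using smooth_linear[of "\<lambda>x. complex_of_real (f x)" "\<lambda>x. complex_of_real (g x)" "complex_of_real c" "complex_of_real d"]
      f g by (simp add: test_fun_def)
  moreover have "compact (tsupp ?h)"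
  proof -
    have "{x. ?h x \<noteq> 0} \<subseteq> {x. f x \<noteq> 0} \<union> {x. g x \<noteq> 0}" by auto
    then have "tsupp ?h \<subseteq> tsupp f \<union> tsupp g"
      unfolding tsupp_def closure_Un[symmetric] by (rule closure_mono)
    then have "tsupp ?h = (tsupp f \<union> tsupp g) \<inter> tsupp ?h" by blast
    also have "compact \<dots>"
      using f g by (intro compact_Int_closed compact_Un) (simp_all add: test_fun_def tsupp_def)
    finally show ?thesis .
  qed
  ultimately show ?thesis using f g by (simp add: test_fun_def)
qed

lemma test_fun_schwartz:
  assumes "test_fun a g" shows "schwartz (\<lambda>x. complex_of_real (g x))"
proof (rule schwartz_compact_support)
  show "compact (tsupp (\<lambda>x. complex_of_real (g x)))" using assms by (simp add: test_fun_def tsupp_def)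
qed (use assms in \<open>simp add: test_fun_def\<close>)

lemma test_fun_tsupp: "test_fun a g \<Longrightarrow> tsupp g \<subseteq> closure a"
  unfolding tsupp_def test_fun_def by (intro closure_minimal) auto

section \<open>The connection of a quantum field\<close>

lemma set_wreduce: "set (wreduce w) \<subseteq> set w"
proof (induction w)
  case (Cons b w)
  then show ?case by (cases "wreduce w") auto
qed simp

lemma sbar_simps [simp]: "sbar (sbar b) = b" "sup1 (sbar b) = sup1 b" "bd0 (sbar b) = bd1 b"
    "bd1 (sbar b) = bd0 b" "sbar (sact p b) = sact p (sbar b)" "interior_s (sbar b) = interior_s b"
  by (auto simp: sbar_def sup1_def bd0_def bd1_def sact_def interior_s_def)

lemma sact_simps [simp]: "sup1 (sact p b) = pact p ` sup1 b" "bd0 (sact p b) = pact p ` bd0 b"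
    "bd1 (sact p b) = pact p ` bd1 b"
  by (simp_all add: sact_def sup1_def bd0_def bd1_def)

lemma sbar_simplices1: "b \<in> simplices1 \<Longrightarrow> sbar b \<in> simplices1"
  by (simp add: simplices1_def)

lemma sbar_T1: "b \<in> T1 \<Longrightarrow> sbar b \<in> T1"
  by (simp add: T1_def sbar_simplices1)

lemma T1_simplices1: "b \<in> T1 \<Longrightarrow> b \<in> simplices1"
  by (simp add: T1_def)

lemma sact_simplices1: "p \<in> poinc \<Longrightarrow> b \<in> simplices1 \<Longrightarrow> sact p b \<in> simplices1"
  by (auto simp: simplices1_def dcones_pact)

lemma interior_s_sact: "p \<in> poinc \<Longrightarrow> interior_s (sact p b) = pact p ` interior_s b"
  by (simp add: interior_s_def image_set_diff pact_inj image_Un)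

lemma interior_s_borel: "b \<in> simplices1 \<Longrightarrow> interior_s b \<in> sets borel"
  unfolding interior_s_def
  by (intro sets.Diff sets.Un borel_open dcones_open) (simp_all add: simplices1_def)

text \<open>Free reduction introduces no new letters, and the letters of an inverse loop lie in
  \<open>T1\<close> because exchanging faces preserves \<open>T1\<close>.\<close>

lemma LK_letters:
  assumes "w \<in> LK" shows "set w \<subseteq> T1"
proof -
  obtain ls where w: "w = wreduce (concat ls)" "\<And>l. l \<in> set ls \<Longrightarrow> is_loop l \<or> is_loop (winv l)"
    using assms by (auto simp: LK_def)
  have "set l \<subseteq> T1" if "is_loop (winv l)" for l
  proof
    fix b assume "b \<in> set l"
    then have "sbar b \<in> set (winv l)" by (simp add: winv_def)
    then have "sbar b \<in> T1" using that by (auto simp: is_loop_def)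
    from sbar_T1[OF this] show "b \<in> T1" by simp
  qed
  moreover have "set l \<subseteq> T1" if "is_loop l" for l using that by (simp add: is_loop_def)
  ultimately have "set (concat ls) \<subseteq> T1" using w(2) by (simp only: set_concat) blast
  then show ?thesis using set_wreduce w(1) by blast
qed

lemma uword_commute:
  assumes "\<And>b c. b \<in> set v \<Longrightarrow> c \<in> set w \<Longrightarrow> u b \<circ> u c = u c \<circ> u b"
  shows "uword u v \<circ> uword u w = uword u w \<circ> uword u v"
proof -
  have one: "u b (uword u w x) = uword u w (u b x)" if "b \<in> set v" for b x
    using assms[OF that]
  proof (induction w arbitrary: x)
    case (Cons c w)
    have "u b (u c y) = u c (u b y)" for y using Cons.prems[of c] by (simp add: fun_eq_iff)
    then show ?case using Cons by (simp add: uword_def)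
  qed (simp add: uword_def)
  have "uword u v (uword u w x) = uword u w (uword u v x)" for x
    using one by (induction v) (simp_all add: uword_def)
  then show ?thesis by (simp add: fun_eq_iff)
qed

lemma tsupp_scale: "c \<noteq> 0 \<Longrightarrow> tsupp (\<lambda>x. c * g x) = tsupp g" for g :: "pt \<Rightarrow> real"
  by (simp add: tsupp_def)

lemma fodd_eq: "fodd f b = (\<lambda>x. (1/2) * f b x + (- 1/2) * f (sbar b) x)"
  by (auto simp: fodd_def field_simps)

lemma fev_eq: "fev f b = (\<lambda>x. (1/2) * f b x + (1/2) * f (sbar b) x)"
  by (auto simp: fev_def field_simps)

section \<open>Exponentials of the smeared field\<close>

locale field_cochain =
  fixes sc :: "complex \<Rightarrow> 'h::{real_inner,complete_space} \<Rightarrow> 'h"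
    and \<Gamma> :: "poinc_el \<Rightarrow> 'h \<Rightarrow> 'h"
    and D :: "'h set"
    and \<Phi> :: "(pt \<Rightarrow> complex) \<Rightarrow> 'h \<Rightarrow> 'h"
    and \<Omega> :: 'h
    and f :: "spx \<Rightarrow> pt \<Rightarrow> real"
  assumes wightman: "wightman_field sc \<Gamma> D \<Phi> \<Omega>"
    and P1: "propP1 sc D \<Phi>"
    and P2: "propP2 sc D \<Phi>"
    and cochain: "inv_cochain1 f"
begin

lemma cs: "complex_structure sc"
  using wightman unfolding wightman_field_def by (elim conjE)

lemma rep: "unitary_rep sc \<Gamma>"
  using wightman unfolding wightman_field_def by (elim conjE)

lemma strong: "strongly_continuous \<Gamma>"
  using wightman unfolding wightman_field_def by (elim conjE)

lemma dense: "closure D = UNIV"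
  using wightman unfolding wightman_field_def by (elim conjE)

lemma field_scale: "\<forall>f c. schwartz f \<longrightarrow> (\<forall>x\<in>D. \<Phi> (\<lambda>y. c * f y) x = sc c (\<Phi> f x))"
  using wightman unfolding wightman_field_def by (elim conjE)

lemma covariance: "\<forall>p\<in>poinc. \<forall>f. schwartz f \<longrightarrow> (\<forall>\<psi>\<in>D. \<Gamma> p (\<Phi> f (\<Gamma> (pinv p) \<psi>)) = \<Phi> (f \<circ> pact (pinv p)) \<psi>)"
  using wightman unfolding wightman_field_def by (elim conjE)

lemma invariant: "\<forall>p\<in>poinc. \<Gamma> p ` D \<subseteq> D"
  using wightman unfolding wightman_field_def by (elim conjE)

lemma Gamma_unitary: "p \<in> poinc \<Longrightarrow> unitary sc (\<Gamma> p)"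
  using rep by (simp add: unitary_rep_def)

lemma Gamma_inverse:
  assumes "p \<in> poinc" "q \<in> poinc" "pmult p q = pone" shows "\<Gamma> p (\<Gamma> q x) = x"
proof -
  have "\<Gamma> (pmult p q) = \<Gamma> p \<circ> \<Gamma> q" using rep assms(1,2) by (simp add: unitary_rep_def)
  then show ?thesis using rep assms(3) by (simp add: unitary_rep_def fun_eq_iff)
qed

lemma Gamma_domain:
  assumes "p \<in> poinc" shows "\<Gamma> p ` D = D"
proof
  show "D \<subseteq> \<Gamma> p ` D"
  proof
    fix x assume "x \<in> D"
    then have "\<Gamma> (pinv p) x \<in> D" using invariant pinv_poinc[OF assms] by blast
    moreover have "x = \<Gamma> p (\<Gamma> (pinv p) x)"
      using Gamma_inverse[OF assms pinv_poinc[OF assms] pmult_pinv(1)[OF assms]] by simp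
    ultimately show "x \<in> \<Gamma> p ` D" by blast
  qed
qed (use invariant assms in blast)

lemma cochain_test_fun: "b \<in> simplices1 \<Longrightarrow> test_fun (sup1 b) (f b)"
  using cochain by (simp add: inv_cochain1_def cochain1_def)

lemma fodd_test_fun: "b \<in> simplices1 \<Longrightarrow> test_fun (sup1 b) (fodd f b)"
  unfolding fodd_eq
  using cochain_test_fun[of b] cochain_test_fun[OF sbar_simplices1, of b] by (intro test_fun_linear) simp_all

lemma fev_test_fun: "b \<in> simplices1 \<Longrightarrow> test_fun (sup1 b) (fev f b)"
  unfolding fev_eq
  using cochain_test_fun[of b] cochain_test_fun[OF sbar_simplices1, of b] by (intro test_fun_linear) simp_all

lemma cochain_sact:
  assumes "p \<in> poinc" "b \<in> simplices1"
  shows "fodd f (sact p b) (pact p x) = fodd f b x" "fev f (sact p b) (pact p x) = fev f b x"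
proof -
  have "f (sact p c) (pact p x) = f c x" if "c \<in> simplices1" for c
    using cochain assms(1) that by (simp add: inv_cochain1_def fun_eq_iff)
  then show "fodd f (sact p b) (pact p x) = fodd f b x" "fev f (sact p b) (pact p x) = fev f b x"
    using assms(2) sbar_simplices1[OF assms(2)] by (simp_all add: fodd_def fev_def)
qed

definition smeared :: "spx \<Rightarrow> pt \<Rightarrow> complex" where
  "smeared b = (\<lambda>x. complex_of_real (fodd f b x))"

text \<open>Separating the group from the time at which it is evaluated lets antisymmetry,
  covariance and commutation be proved for all times; of \<open>weight\<close> only its invariance
  then matters.\<close>

definition evolution :: "spx \<Rightarrow> real \<Rightarrow> 'h \<Rightarrow> 'h" where
  "evolution b = uexp sc (op_closure D (\<Phi> (smeared b)))"

definition weight :: "spx \<Rightarrow> real" where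
  "weight b = (LINT x : interior_s b | lborel. \<bar>fev f b x\<bar>)"

lemma Phi_conn_eq: "Phi_conn sc D \<Phi> f b = evolution b (weight b)"
  by (simp add: Phi_conn_def evolution_def smeared_def weight_def)

lemma smeared_schwartz: "b \<in> simplices1 \<Longrightarrow> schwartz (smeared b)"
  unfolding smeared_def by (rule test_fun_schwartz[OF fodd_test_fun])

lemma smeared_ess_self_adjoint: "b \<in> simplices1 \<Longrightarrow> ess_self_adjoint sc D (\<Phi> (smeared b))"
  using P1 smeared_schwartz unfolding propP1_def smeared_def by blast

lemma evolution_group: "b \<in> simplices1 \<Longrightarrow> unitary_group_of sc (evolution b) (op_closure D (\<Phi> (smeared b)))"
  unfolding evolution_def by (rule ess_self_adjoint_uexp[OF cs smeared_ess_self_adjoint dense])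

lemma evolution_unitary: "b \<in> simplices1 \<Longrightarrow> unitary sc (evolution b t)"
  and evolution_zero: "b \<in> simplices1 \<Longrightarrow> evolution b 0 = id"
  and evolution_add: "b \<in> simplices1 \<Longrightarrow> evolution b (s + t) = evolution b s \<circ> evolution b t"
  using evolution_group by (simp_all add: unitary_group_of_def)

text \<open>Exchanging the faces changes the sign of \<open>fodd\<close> and hence of the generator,
  which reverses time in the group.\<close>

lemma evolution_sbar:
  assumes b: "b \<in> simplices1" shows "evolution (sbar b) t = inv (evolution b t)"
proof -
  have s: "smeared (sbar b) = (\<lambda>y. (- 1) * smeared b y)"
    by (auto simp: smeared_def fodd_def field_simps)
  have "\<Phi> (smeared (sbar b)) x = sc (- 1) (\<Phi> (smeared b) x)" if "x \<in> D" for x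
    unfolding s by (rule field_scale[rule_format, OF smeared_schwartz[OF b] that])
  then have "\<Phi> (smeared (sbar b)) x = (- 1) *\<^sub>R \<Phi> (smeared b) x" if "x \<in> D" for x
    using that sc_of_real[OF cs, of "-1"] by simp
  then have "evolution (sbar b) t = evolution b (- 1 * t)"
    unfolding evolution_def by (intro uexp_rescale[OF cs smeared_ess_self_adjoint[OF b] dense]) simp_all
  moreover have "inv (evolution b t) = evolution b (- t)"
    using evolution_add[OF b, of t "- t"] evolution_add[OF b, of "- t" t] evolution_zero[OF b]
    by (intro inv_unique_comp) simp_all
  ultimately show ?thesis by simp
qed

lemma weight_sbar: "weight (sbar b) = weight b"
  by (simp add: weight_def fev_def add.commute)

text \<open>Invariance of the cochain pulls back the integrand, equivariance of
  \<open>interior_s\<close> the domain, and the measure is preserved.\<close>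

lemma weight_sact:
  assumes p: "p \<in> poinc" and b: "b \<in> simplices1" shows "weight (sact p b) = weight b"
proof -
  have "(\<lambda>x. \<bar>fev f (sact p b) x\<bar>) \<in> borel_measurable borel"
    using test_fun_continuous[OF fev_test_fun[OF sact_simplices1[OF p b]]]
    by (intro borel_measurable_continuous_onI continuous_intros)
  then show ?thesis
    unfolding weight_def interior_s_sact[OF p]
    by (subst set_integral_pact[OF p interior_s_borel[OF b]]) (simp_all add: cochain_sact[OF p b])
qed

lemma evolution_sact:
  assumes p: "p \<in> poinc" and b: "b \<in> simplices1"
  shows "evolution (sact p b) t = \<Gamma> p \<circ> evolution b t \<circ> inv (\<Gamma> p)"
  unfolding evolution_def
proof (rule uexp_conj[OF cs smeared_ess_self_adjoint[OF b] dense Gamma_unitary[OF p] Gamma_domain[OF p]])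
  fix x assume x: "x \<in> D"
  \<comment> \<open>Invariance of the cochain identifies the transformed test function with that of
    the transformed simplex.\<close>
  have "smeared b \<circ> pact (pinv p) = smeared (sact p b)"
  proof
    fix y
    show "(smeared b \<circ> pact (pinv p)) y = smeared (sact p b) y"
      using cochain_sact(1)[OF p b, of "pact (pinv p) y"] by (simp add: smeared_def pact_pinv[OF p])
  qed
  moreover have "\<Gamma> p x \<in> D" using x Gamma_domain[OF p] by blast
  moreover have "\<Gamma> (pinv p) (\<Gamma> p x) = x"
    by (rule Gamma_inverse[OF pinv_poinc[OF p] p pmult_pinv(2)[OF p]])
  ultimately show "\<Phi> (smeared (sact p b)) (\<Gamma> p x) = \<Gamma> p (\<Phi> (smeared b) x)"
    using covariance p smeared_schwartz[OF b] by metis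
qed

text \<open>Nonzero times become factors of the test functions by \<open>uexp_rescale\<close>, which
  leaves the supports unchanged, so P2 at time 1 applies; at time 0 one of the maps is the
  identity.\<close>

lemma evolution_commute_spacelike:
  assumes b: "b \<in> simplices1" and c: "c \<in> simplices1" and "perp (tsupp (fodd f b)) (tsupp (fodd f c))"
  shows "evolution b s \<circ> evolution c t = evolution c t \<circ> evolution b s"
proof (cases "s = 0 \<or> t = 0")
  case False
  have scaled: "schwartz (\<lambda>x. complex_of_real (r * fodd f a x)) \<and>
      uexp sc (op_closure D (\<Phi> (\<lambda>x. complex_of_real (r * fodd f a x)))) 1 = evolution a r"
    if a: "a \<in> simplices1" and r: "r \<noteq> 0" for a r
  proof
    have "test_fun (sup1 a) (\<lambda>x. r * fodd f a x)"
      using test_fun_linear[OF fodd_test_fun[OF a] fodd_test_fun[OF a], of r 0] by simp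
    then show "schwartz (\<lambda>x. complex_of_real (r * fodd f a x))" by (rule test_fun_schwartz)
    have e: "(\<lambda>x. complex_of_real (r * fodd f a x)) = (\<lambda>x. complex_of_real r * smeared a x)"
      by (simp add: smeared_def)
    have "\<Phi> (\<lambda>x. complex_of_real r * smeared a x) y = r *\<^sub>R \<Phi> (smeared a) y" if "y \<in> D" for y
      using field_scale smeared_schwartz[OF a] that sc_of_real[OF cs, of r] by simp
    then have "uexp sc (op_closure D (\<Phi> (\<lambda>x. complex_of_real r * smeared a x))) 1 = evolution a (r * 1)"
      unfolding evolution_def by (intro uexp_rescale[OF cs smeared_ess_self_adjoint[OF a] dense r])
    then show "uexp sc (op_closure D (\<Phi> (\<lambda>x. complex_of_real (r * fodd f a x)))) 1 = evolution a r"
      unfolding e by simp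
  qed
  have "spacelike_sets (tsupp (\<lambda>x. s * fodd f b x)) (tsupp (\<lambda>x. t * fodd f c x))"
    using False assms(3) by (simp add: tsupp_scale spacelike_sets_def)
  then show ?thesis
    using P2 scaled[OF b, of s] scaled[OF c, of t] False unfolding propP2_def by metis
next
  case True
  then show ?thesis using evolution_zero[OF b] evolution_zero[OF c] by auto
qed

lemma translation_tendsto: "(\<lambda>n. \<Gamma> (mat 1, inverse (real (Suc n)) *\<^sub>R a) x) \<longlonglongrightarrow> x"
proof -
  have "(\<lambda>n. (mat 1, inverse (real (Suc n)) *\<^sub>R a)) \<longlonglongrightarrow> (mat 1 :: real^4^4, 0 *\<^sub>R a)"
    by (intro tendsto_intros LIMSEQ_inverse_real_of_nat)
  then have "(\<lambda>n. \<Gamma> (mat 1, inverse (real (Suc n)) *\<^sub>R a) x) \<longlonglongrightarrow> \<Gamma> (mat 1, 0 *\<^sub>R a) x"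
    using strong unfolding strongly_continuous_def
    by (intro continuous_on_tendsto_compose[of poinc "\<lambda>p. \<Gamma> p x"]) (auto simp: translation_poinc)
  moreover have "\<Gamma> (mat 1, 0) = id" using rep by (simp add: unitary_rep_def pone_def)
  ultimately show ?thesis by simp
qed

lemma unitary_nonexpansive: "unitary sc T \<Longrightarrow> nonexpansive T"
  using unitary_bounded_linear[OF cs, of T]
  by (simp add: nonexpansive_def unitary_def bounded_linear.linear flip: linear_diff)

text \<open>P2 does not apply directly: the supports are only known to lie in the closures of the two double
  cones, which need not be spacelike separated. Translating one of them apart and using strong
  continuity of the representation removes the obstruction.\<close>

lemma evolution_commute:
  assumes b: "b \<in> simplices1" and c: "c \<in> simplices1"
    and o: "o1 \<in> dcones" "o2 \<in> dcones" "perp o1 o2" "sup1 b \<subseteq> o1" "sup1 c \<subseteq> o2"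
  shows "evolution b s \<circ> evolution c t = evolution c t \<circ> evolution b s"
proof
  fix x
  obtain a where a: "\<And>e. e > 0 \<Longrightarrow> perp (pact (mat 1, e *\<^sub>R a) ` closure o1) (closure o2)"
    using perp_separation[OF o(1-3)] by blast
  define p where "p n = (mat 1 :: real^4^4, inverse (real (Suc n)) *\<^sub>R a)" for n
  define q where "q n = (mat 1 :: real^4^4, inverse (real (Suc n)) *\<^sub>R (- a))" for n
  have pq: "p n \<in> poinc" "q n \<in> poinc" "pmult (p n) (q n) = pone" for n
    by (simp_all add: p_def q_def translation_poinc pmult_def pone_def)
  have inv: "inv (\<Gamma> (p n)) y = \<Gamma> (q n) y" for n y
    using Gamma_unitary[OF pq(1)] Gamma_inverse[OF pq]
    by (simp add: unitary_def inv_f_eq bij_is_inj)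
  have comm: "evolution (sact (p n) b) s (evolution c t y) = evolution c t (evolution (sact (p n) b) s y)" for n y
  proof -
    have pb: "sact (p n) b \<in> simplices1" by (rule sact_simplices1[OF pq(1) b])
    have "tsupp (fodd f (sact (p n) b)) \<subseteq> pact (p n) ` closure (sup1 b)"
      using test_fun_tsupp[OF fodd_test_fun[OF pb]] by (simp add: closure_pact_image[OF pq(1)])
    also have "\<dots> \<subseteq> pact (p n) ` closure o1" by (intro image_mono closure_mono o)
    finally have "tsupp (fodd f (sact (p n) b)) \<subseteq> pact (p n) ` closure o1" .
    moreover have "tsupp (fodd f c) \<subseteq> closure o2"
      using test_fun_tsupp[OF fodd_test_fun[OF c]] closure_mono[OF o(5)] by blast
    moreover have "perp (pact (p n) ` closure o1) (closure o2)" unfolding p_def by (rule a) simp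
    ultimately have "perp (tsupp (fodd f (sact (p n) b))) (tsupp (fodd f c))"
      unfolding perp_def by blast
    from evolution_commute_spacelike[OF pb c this, of s t] show ?thesis by (simp add: fun_eq_iff)
  qed
  have cont: "isCont (evolution d r) y" if "d \<in> simplices1" for d r y
    by (intro nonexpansive_isCont unitary_nonexpansive evolution_unitary that)
  \<comment> \<open>By covariance the translated simplex gives the group conjugated by translations,
    and both conjugating factors tend strongly to the identity.\<close>
  have lim: "(\<lambda>n. evolution (sact (p n) b) s y) \<longlonglongrightarrow> evolution b s y" for y
  proof -
    have "(\<lambda>n. \<Gamma> (q n) y) \<longlonglongrightarrow> y" unfolding q_def by (rule translation_tendsto)
    then have "(\<lambda>n. evolution b s (\<Gamma> (q n) y)) \<longlonglongrightarrow> evolution b s y"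
      by (rule isCont_tendsto_compose[OF cont[OF b]])
    then have "(\<lambda>n. \<Gamma> (p n) (evolution b s (\<Gamma> (q n) y))) \<longlonglongrightarrow> evolution b s y"
      using nonexpansive_tendsto[of "\<lambda>n. \<Gamma> (p n)"] unitary_nonexpansive[OF Gamma_unitary[OF pq(1)]]
        translation_tendsto[of a "evolution b s y"] unfolding p_def by blast
    then show ?thesis by (simp add: evolution_sact[OF pq(1) b] inv)
  qed
  have "(\<lambda>n. evolution c t (evolution (sact (p n) b) s x)) \<longlonglongrightarrow> evolution c t (evolution b s x)"
    by (rule isCont_tendsto_compose[OF cont[OF c] lim])
  \<comment> \<open>The same sequence, rewritten by \<open>comm\<close>, converges to the product in
    the other order.\<close>
  moreover have "(\<lambda>n. evolution c t (evolution (sact (p n) b) s x)) \<longlonglongrightarrow> evolution b s (evolution c t x)"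
    using lim[of "evolution c t x"] by (simp only: comm)
  ultimately show "(evolution b s \<circ> evolution c t) x = (evolution c t \<circ> evolution b s) x"
    by (simp add: LIMSEQ_unique)
qed

lemma Phi_conn_connection: "causal_cov_connection sc (Phi_conn sc D \<Phi> f) \<Gamma>"
  unfolding causal_cov_connection_def
proof (intro conjI ballI impI rep)
  fix b assume "b \<in> T1"
  then have b: "b \<in> simplices1" by (rule T1_simplices1)
  show "unitary sc (Phi_conn sc D \<Phi> f b)"
    unfolding Phi_conn_eq by (rule evolution_unitary[OF b])
  show "Phi_conn sc D \<Phi> f (sbar b) = inv (Phi_conn sc D \<Phi> f b)"
    unfolding Phi_conn_eq weight_sbar by (rule evolution_sbar[OF b])
next
  fix p b assume p: "p \<in> poinc" and "b \<in> T1"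
  then have b: "b \<in> simplices1" by (simp add: T1_simplices1)
  have "inv (\<Gamma> p) \<circ> \<Gamma> p = id" using Gamma_unitary[OF p] by (simp add: unitary_def bij_is_inj)
  then show "\<Gamma> p \<circ> Phi_conn sc D \<Phi> f b = Phi_conn sc D \<Phi> f (sact p b) \<circ> \<Gamma> p"
    unfolding Phi_conn_eq weight_sact[OF p b] evolution_sact[OF p b] by (simp add: fun_eq_iff)
next
  fix v w assume v: "v \<in> LK" and w: "w \<in> LK" and "wperp v w"
  then obtain o1 o2 where o: "o1 \<in> dcones" "o2 \<in> dcones" "perp o1 o2"
      "\<forall>b\<in>set v. sup1 b \<subseteq> o1" "\<forall>b\<in>set w. sup1 b \<subseteq> o2"
    unfolding wperp_def by blast
  show "uword (Phi_conn sc D \<Phi> f) v \<circ> uword (Phi_conn sc D \<Phi> f) w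
      = uword (Phi_conn sc D \<Phi> f) w \<circ> uword (Phi_conn sc D \<Phi> f) v"
  proof (rule uword_commute)
    fix b c assume b: "b \<in> set v" and c: "c \<in> set w"
    show "Phi_conn sc D \<Phi> f b \<circ> Phi_conn sc D \<Phi> f c = Phi_conn sc D \<Phi> f c \<circ> Phi_conn sc D \<Phi> f b"
      unfolding Phi_conn_eq
      by (rule evolution_commute[OF _ _ o(1-3)])
        (use b c o(4,5) LK_letters[OF v] LK_letters[OF w] T1_simplices1 in blast)+
  qed
qed

text \<open>A face equal to the whole support empties the interior, so the group is evaluated at
  time 0.\<close>

lemma Phi_conn_degenerate:
  assumes "b \<in> N1" shows "Phi_conn sc D \<Phi> f b = id"
proof -
  have "interior_s b = {}" using assms by (auto simp: N1_def interior_s_def)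
  then have "weight b = 0" by (simp add: weight_def set_lebesgue_integral_def)
  then show ?thesis using assms evolution_zero[of b] by (simp add: Phi_conn_eq N1_def)
qed

end

theorem theorem4p14:
  fixes sc :: "complex \<Rightarrow> 'h::{real_inner,complete_space} \<Rightarrow> 'h"
    and \<Gamma> :: "poinc_el \<Rightarrow> 'h \<Rightarrow> 'h"
    and D :: "'h set"
    and \<Phi> :: "(pt \<Rightarrow> complex) \<Rightarrow> 'h \<Rightarrow> 'h"
    and \<Omega> :: 'h
    and f :: "spx \<Rightarrow> pt \<Rightarrow> real"
  assumes "wightman_field sc \<Gamma> D \<Phi> \<Omega>"
    and "propP1 sc D \<Phi>"
    and "propP2 sc D \<Phi>"
    and "inv_cochain1 f"
    and "\<exists>b\<in>simplices1. f b \<noteq> (\<lambda>x. 0)"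
  shows "causal_cov_connection sc (Phi_conn sc D \<Phi> f) \<Gamma> \<and> cont_covariant \<Gamma>
         \<and> (\<forall>b\<in>N1. Phi_conn sc D \<Phi> f b = id)"
proof -
  interpret field_cochain sc \<Gamma> D \<Phi> \<Omega> f
    using assms(1-4) by unfold_locales
  show ?thesis
    using Phi_conn_connection strong Phi_conn_degenerate by (simp add: cont_covariant_def)
qed

end
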